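(* Let $0<\nu\le \tfrac12$, $\lambda>0$, $\Lambda>0$. Let $N$ be a homogeneous Poisson process with rate $\Lambda$, and let $\mathcal{L}^\nu$ be the inverse of the sum of stable subordinators $H_1^{2\nu}(t)+(2\lambda)^{1/\nu}H_2^{\nu}(t)$, independent of $N$. Then the probabilities $p_k^\nu(t)=\mathsf{P}\{N(\mathcal{L}^\nu(t))=k\}$ satisfy $$\frac{d^{2\nu} p_k^\nu(t)}{dt^{2\nu}} + 2\lambda \frac{d^\nu p_k^\nu(t)}{dt^\nu} = -\Lambda\left(p_k^\nu(t) - p_{k-1}^\nu(t)\right), \quad k \ge 0,\ t>0,$$ with $p_{-1}^\nu\equiv 0$ and the initial condition $p_k^\nu(0)=1$ for $k=0$, $p_k^\nu(0)=0$ for $k\ge1$, where the fractional derivatives are in the Caputo–Djrbashian sense.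
   Context: For $\beta\in(0,1)$, a stable subordinator $H^{\beta}$ is a nondecreasing Lévy process with $\mathsf{E}e^{-sH^{\beta}(t)}=e^{-ts^{\beta}}$, $s>0$; for $\beta=1$ set $H^1(t)=t$. $H_1^{2\nu}$ and $H_2^\nu$ are independent stable subordinators of orders $2\nu$ and $\nu$. The inverse process is $$\mathcal{L}^\nu(t)=\inf\{s>0: H_1^{2\nu}(s)+(2\lambda)^{1/\nu}H_2^\nu(s)\ge t\},\quad t>0,\qquad \mathcal{L}^\nu(0)=0.$$ The Caputo–Djrbashian derivative of order $\beta\in(0,1)$ is $\frac{d^{\beta}}{dt^{\beta}}u(t)=\frac{1}{\Gamma(1-\beta)}\int_0^t \frac{u'(s)}{(t-s)^{\beta}}\,ds$; for $\beta=1$ it is the ordinary derivative. *)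

theory Defs
  imports "HOL-Probability.Probability"
begin

text \<open>
  A process is a map \<open>X\<close> sending a time and an outcome to a real; only times \<open>t \<ge> 0\<close> matter.
  Path properties hold for every outcome, not just almost every one, so that the inverse process
  and the composition with it below are measurable without completing \<open>M\<close>.
\<close>

text \<open>
  Stochastic continuity is not listed separately: it follows from stationarity of the increments
  and right-continuity of the paths at \<open>0\<close>.
\<close>

definition (in prob_space) levy_process :: "(real \<Rightarrow> 'a \<Rightarrow> real) \<Rightarrow> bool" where
  "levy_process X \<longleftrightarrow>
     (\<forall>t\<ge>0. random_variable borel (X t)) \<and>
     (\<forall>\<omega>\<in>space M. X 0 \<omega> = 0) \<and>
     (\<forall>(n::nat) ts. 0 \<le> ts 0 \<and> mono_on {..n} ts \<longrightarrow>
        indep_vars (\<lambda>_. borel) (\<lambda>i \<omega>. X (ts (Suc i)) \<omega> - X (ts i) \<omega>) {..<n}) \<and>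
     (\<forall>s t. 0 \<le> s \<and> s \<le> t \<longrightarrow>
        distr M borel (\<lambda>\<omega>. X t \<omega> - X s \<omega>) = distr M borel (X (t - s))) \<and>
     (\<forall>\<omega>\<in>space M. \<forall>t\<ge>0. ((\<lambda>s. X s \<omega>) \<longlongrightarrow> X t \<omega>) (at_right t)) \<and>
     (\<forall>\<omega>\<in>space M. \<forall>t>0. \<exists>l. ((\<lambda>s. X s \<omega>) \<longlongrightarrow> l) (at_left t))"

definition (in prob_space) stable_subordinator :: "real \<Rightarrow> (real \<Rightarrow> 'a \<Rightarrow> real) \<Rightarrow> bool" where
  "stable_subordinator \<beta> H \<longleftrightarrow>
     (if \<beta> = 1 then \<forall>\<omega>\<in>space M. \<forall>t\<ge>0. H t \<omega> = t
      else 0 < \<beta> \<and> \<beta> < 1 \<and> levy_process H \<and>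
        (\<forall>\<omega>\<in>space M. mono_on {0..} (\<lambda>t. H t \<omega>)) \<and>
        (\<forall>t\<ge>0. \<forall>s>0. expectation (\<lambda>\<omega>. exp (- s * H t \<omega>)) = exp (- t * s powr \<beta>)))"

definition (in prob_space) poisson_process :: "real \<Rightarrow> (real \<Rightarrow> 'a \<Rightarrow> nat) \<Rightarrow> bool" where
  "poisson_process r N \<longleftrightarrow>
     levy_process (\<lambda>t \<omega>. real (N t \<omega>)) \<and>
     (\<forall>\<omega>\<in>space M. mono_on {0..} (\<lambda>t. N t \<omega>)) \<and>
     (\<forall>t\<ge>0. \<forall>k. prob {\<omega> \<in> space M. N t \<omega> = k} = (r * t) ^ k / fact k * exp (- (r * t)))"

text \<open>Independence of the sigma-algebras generated by the whole processes.\<close>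

definition (in prob_space) indep_processes ::
    "(real \<Rightarrow> 'a \<Rightarrow> real) \<Rightarrow> (real \<Rightarrow> 'a \<Rightarrow> real) \<Rightarrow> bool" where
  "indep_processes X Y \<longleftrightarrow>
     indep_var (PiM {0..} (\<lambda>_. borel)) (\<lambda>\<omega>. \<lambda>t\<in>{0..}. X t \<omega>)
               (PiM {0..} (\<lambda>_. borel)) (\<lambda>\<omega>. \<lambda>t\<in>{0..}. Y t \<omega>)"

text \<open>
  The set below is empty only on a null event, where \<open>Inf {}\<close> would be an unspecified and possibly
  negative real; there the value \<open>0\<close> is used. The parameter \<open>l\<close> is the constant usually called
  lambda.
\<close>

definition inverse_process ::
    "real \<Rightarrow> real \<Rightarrow> (real \<Rightarrow> 'a \<Rightarrow> real) \<Rightarrow> (real \<Rightarrow> 'a \<Rightarrow> real) \<Rightarrow> real \<Rightarrow> 'a \<Rightarrow> real" where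
  "inverse_process \<nu> l H1 H2 t \<omega> =
     (let S = {s. s > 0 \<and> H1 s \<omega> + (2 * l) powr (1 / \<nu>) * H2 s \<omega> \<ge> t}
      in if t > 0 \<and> S \<noteq> {} then Inf S else 0)"

definition (in prob_space) time_changed_prob ::
    "(real \<Rightarrow> 'a \<Rightarrow> nat) \<Rightarrow> (real \<Rightarrow> 'a \<Rightarrow> real) \<Rightarrow> nat \<Rightarrow> real \<Rightarrow> real" where
  "time_changed_prob N L k t = prob {\<omega> \<in> space M. N (L t \<omega>) \<omega> = k}"

definition caputo_deriv :: "real \<Rightarrow> (real \<Rightarrow> real) \<Rightarrow> real \<Rightarrow> real" where
  "caputo_deriv \<beta> u t =
     (if \<beta> = 1 then deriv u t
      else 1 / Gamma (1 - \<beta>) * (LBINT s:{0<..<t}. deriv u s / (t - s) powr \<beta>))"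

text \<open>
  Both \<open>deriv\<close> and the integral are total functions, so \<open>caputo_deriv\<close> is meaningful only under
  the following condition. For \<open>\<beta> < 1\<close> it makes \<open>u\<close> absolutely continuous on \<open>[0, t]\<close>; in
  particular \<open>u 0\<close> is the limit of \<open>u\<close> at \<open>0\<close>, so it is a genuine initial value.
\<close>

definition caputo_differentiable :: "real \<Rightarrow> (real \<Rightarrow> real) \<Rightarrow> real \<Rightarrow> bool" where
  "caputo_differentiable \<beta> u t \<longleftrightarrow>
     (if \<beta> = 1 then u field_differentiable (at t)
      else continuous_on {0..t} u \<and> (\<forall>s\<in>{0<..<t}. u field_differentiable (at s)) \<and>
        set_integrable lborel {0<..<t} (\<lambda>s. deriv u s / (t - s) powr \<beta>))"

end

theory Submission
  imports Defs
begin

text \<open>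
  Write \<open>S = H1 + (2 l) powr (1 / \<nu>) * H2\<close>. By independence \<open>S\<close> is a subordinator with Laplace
  exponent \<open>\<phi> \<mu> = \<mu> powr (2 * \<nu>) + 2 * l * \<mu> powr \<nu>\<close>, and \<open>L\<close> is its first passage time. In terms
  of Laplace transforms in \<open>t\<close> the equation says
  \<open>\<phi> \<mu> * (P k - \<delta> k) = - \<Lambda> * (P k - P (k - 1))\<close>, where \<open>\<delta> k\<close> is the transform of the constant
  initial value, and this determines
  \<open>P k = \<phi> \<mu> / \<mu> * (\<Lambda> ^ k / (\<Lambda> + \<phi> \<mu>) ^ Suc k)\<close>. The difficulty is that
  the probabilities \<open>p k\<close> are not visibly differentiable. Hence the solution is built
  independently of the processes, and then recognised in \<open>p k\<close> by its Laplace transform.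

  \<^item> Solution. A power series in \<open>t powr \<nu>\<close> whose coefficient at \<open>t powr (\<nu> * m)\<close> is
  \<open>a m / Gamma (\<nu> * m + 1)\<close> has its coefficients shifted by \<open>j\<close> under the Caputo derivative of order
  \<open>\<nu> * j \<le> 1\<close>, provided that \<open>a 1, \<dots>, a (j - 1)\<close> vanish (lemma \<open>caputo_frac_series\<close>). So the
  fractional equation becomes a linear recurrence for the coefficients. Its solution grows at most
  geometrically, which the Gamma function in the denominator beats, so the series converges
  everywhere and satisfies the equation term by term (\<open>state_series_equation\<close>). Its Laplace
  transform for large \<open>\<mu>\<close> is again computed from the recurrence (\<open>state_series_laplace\<close>).

  \<^item> Probabilities. Since \<open>L\<close> is independent of \<open>N\<close>, the probability \<open>p k t\<close> is the expectation of
  the Poisson weight \<open>w k\<close> at \<open>L t\<close> (\<open>poisson_at_independent_time\<close>). Integrating by parts and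
  using \<open>{s < L t} = {S s < t}\<close> almost surely turns this expectation into
  \<open>w k 0\<close> plus the integral of \<open>w k' s * P(S s < t)\<close> over \<open>s > 0\<close>
  (\<open>expectation_first_passage\<close>). This is a left-continuous function of \<open>t\<close>, and Fubini computes its
  Laplace transform from \<open>E exp (- \<mu> * S s) = exp (- s * \<phi> \<mu>)\<close>.

  \<^item> Both have the same Laplace transform for large \<open>\<mu>\<close>, so they agree for all \<open>t > 0\<close> by the
  uniqueness theorem of Lerch for left-continuous functions
  (\<open>laplace_vanishing_left_continuous\<close>), and at \<open>t = 0\<close> by inspection.
\<close>

section \<open>Gamma and Beta integrals\<close>

lemma Gamma_integral_exp:
  fixes y \<mu> :: real
  assumes "y > 0" "\<mu> > 0"
  shows "has_bochner_integral lborel (\<lambda>t. indicator {0<..} t * (t powr (y - 1) * exp (- \<mu> * t)))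
           (Gamma y / \<mu> powr y)"
proof -
  define f :: "real \<Rightarrow> real" where "f = (\<lambda>t. indicator {0<..} t * (t powr (y - 1) * exp (- t)))"
  have "f = (\<lambda>t. indicator {0..} t * t powr (y - 1) / exp t)"
    by (auto simp: f_def fun_eq_iff indicator_def exp_minus field_simps)
  then have "(\<integral>\<^sup>+t. ennreal (f t) \<partial>lborel) = ennreal (Gamma y)"
    using Gamma_conv_nn_integral_real[OF assms(1)] by simp
  then have "has_bochner_integral lborel f (Gamma y)"
    using assms(1) by (intro has_bochner_integral_nn_integral) (auto simp: f_def less_imp_le)
  then have "has_bochner_integral lborel (\<lambda>x. f (0 + \<mu> * x)) (Gamma y /\<^sub>R \<bar>\<mu>\<bar>)"
    using assms(2) by (subst lborel_has_bochner_integral_real_affine_iff[symmetric]) auto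
  then have "has_bochner_integral lborel (\<lambda>x. f (0 + \<mu> * x) * \<mu> powr (1 - y)) (Gamma y /\<^sub>R \<bar>\<mu>\<bar> * \<mu> powr (1 - y))"
    by (intro has_bochner_integral_mult_left)
  also have "(\<lambda>x. f (0 + \<mu> * x) * \<mu> powr (1 - y)) = (\<lambda>t. indicator {0<..} t * (t powr (y - 1) * exp (- \<mu> * t)))"
    using assms(2)
    by (auto simp: f_def fun_eq_iff indicator_def zero_less_mult_iff powr_mult powr_add[symmetric])
  also have "Gamma y /\<^sub>R \<bar>\<mu>\<bar> * \<mu> powr (1 - y) = Gamma y / \<mu> powr y"
    using assms(2) by (simp add: powr_diff field_simps)
  finally show ?thesis .
qed

lemma exp_tail_integral:
  fixes a \<mu> :: real
  assumes "\<mu> > 0"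
  shows "has_bochner_integral lborel (\<lambda>t. indicator {a<..} t * exp (- \<mu> * t)) (exp (- \<mu> * a) / \<mu>)"
proof -
  have "(\<lambda>t. indicator {0<..} t * (t powr (1 - 1) * exp (- \<mu> * t))) = (\<lambda>t. indicator {0<..} t * exp (- \<mu> * t))"
    by (auto simp: fun_eq_iff indicator_def)
  then have "has_bochner_integral lborel (\<lambda>t. indicator {0<..} t * exp (- \<mu> * t)) (1 / \<mu>)"
    using Gamma_integral_exp[of 1 \<mu>] assms by simp
  then have "has_bochner_integral lborel (\<lambda>t. indicator {0<..} (- a + 1 * t) * exp (- \<mu> * (- a + 1 * t))) (1 / \<mu> /\<^sub>R \<bar>1\<bar>)"
    by (subst lborel_has_bochner_integral_real_affine_iff[symmetric]) auto
  then have "has_bochner_integral lborel (\<lambda>t. exp (- \<mu> * a) * (indicator {0<..} (- a + 1 * t) * exp (- \<mu> * (- a + 1 * t)))) (exp (- \<mu> * a) * (1 / \<mu> /\<^sub>R \<bar>1\<bar>))"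
    by (intro has_bochner_integral_mult_right)
  also have "(\<lambda>t. exp (- \<mu> * a) * (indicator {0<..} (- a + 1 * t) * exp (- \<mu> * (- a + 1 * t)))) = (\<lambda>t. indicator {a<..} t * exp (- \<mu> * t))"
    by (auto simp: fun_eq_iff indicator_def mult_exp_exp algebra_simps)
  finally show ?thesis by simp
qed

lemma Beta_integral_scaled:
  fixes a b T :: real
  assumes "a > 0" "b > 0" "T > 0"
  shows "has_bochner_integral lborel
           (\<lambda>s. indicator {0<..<T} s * (s powr (a - 1) * (T - s) powr (b - 1)))
           (Beta a b * T powr (a + b - 1))"
proof -
  define f :: "real \<Rightarrow> real" where
    "f = (\<lambda>t. indicator {0..1} t * (t powr (a - 1) * (1 - t) powr (b - 1)))"
  have "(\<integral>\<^sup>+t. ennreal (f t) \<partial>lborel) = ennreal (Beta a b)"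
    using nn_integral_has_integral_lebesgue[OF _ has_integral_Beta_real[OF assms(1,2)]]
    by (simp add: f_def)
  moreover have "Beta a b \<ge> 0" using assms by (auto simp: Beta_def intro!: divide_nonneg_pos mult_nonneg_nonneg less_imp_le)
  ultimately have "has_bochner_integral lborel f (Beta a b)"
    by (intro has_bochner_integral_nn_integral) (auto simp: f_def)
  then have "has_bochner_integral lborel (\<lambda>x. f (0 + (1/T) * x)) (Beta a b /\<^sub>R \<bar>1/T\<bar>)"
    using assms(3) by (subst lborel_has_bochner_integral_real_affine_iff[symmetric]) auto
  then have "has_bochner_integral lborel (\<lambda>x. f (0 + (1/T) * x) * T powr (a + b - 2))
     (Beta a b /\<^sub>R \<bar>1/T\<bar> * T powr (a + b - 2))"
    by (intro has_bochner_integral_mult_left)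
  also have "(\<lambda>x. f (0 + (1/T) * x) * T powr (a + b - 2)) =
     (\<lambda>s. indicator {0<..<T} s * (s powr (a - 1) * (T - s) powr (b - 1)))"
  proof
    fix x
    show "f (0 + (1/T) * x) * T powr (a + b - 2) = indicator {0<..<T} x * (x powr (a - 1) * (T - x) powr (b - 1))"
    proof (cases "x \<in> {0<..<T}")
      case True
      have "1 - x / T = (T - x) / T" using assms by (simp add: field_simps)
      then have "(x / T) powr (a - 1) * (1 - x / T) powr (b - 1) * T powr (a + b - 2) =
         x powr (a - 1) * (T - x) powr (b - 1) * (T powr (a + b - 2) / (T powr (a - 1) * T powr (b - 1)))"
        using True assms by (simp add: powr_divide)
      also have "T powr (a - 1) * T powr (b - 1) = T powr (a + b - 2)"
        by (simp add: powr_add[symmetric] algebra_simps)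
      finally show ?thesis using True assms by (simp add: f_def)
    next
      case False
      then show ?thesis using assms
        by (cases "x = 0 \<or> x = T") (auto simp: f_def indicator_def field_simps)
    qed
  qed
  also have "T * T powr (a + b - 2) = T powr (1 + (a + b - 2))"
    using assms by (subst powr_add) auto
  then have "Beta a b /\<^sub>R \<bar>1/T\<bar> * T powr (a + b - 2) = Beta a b * T powr (a + b - 1)"
    using assms by (simp add: algebra_simps)
  finally show ?thesis .
qed

text \<open>
  On the unit interval after \<open>R\<close> the integrand of the Gamma integral is at least
  \<open>R powr y * exp (- (R + 1))\<close>. As \<open>R\<close> is free, this gives growth in \<open>y\<close> faster than any geometric
  sequence, which is all that convergence of the series below requires.
\<close>

lemma Gamma_lower_bound:
  fixes y R :: real
  assumes "y \<ge> 0" "R > 0"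
  shows "R powr y * exp (- (R + 1)) \<le> Gamma (y + 1)"
proof -
  have 1: "has_bochner_integral lborel (\<lambda>t. indicator {0<..} t * (t powr y * exp (- t))) (Gamma (y + 1))"
    using Gamma_integral_exp[of "y + 1" 1] assms by simp
  have "has_bochner_integral lborel (indicator {R..R + 1}) (measure lborel {R..R + 1})"
    by (rule has_bochner_integral_real_indicator) auto
  then have 2: "has_bochner_integral lborel (\<lambda>t. indicator {R..R + 1} t * (R powr y * exp (- (R + 1)))) (R powr y * exp (- (R + 1)))"
    using has_bochner_integral_mult_left[of "R powr y * exp (- (R + 1))" lborel "indicator {R..R + 1}" 1] by simp
  have "indicator {R..R + 1} t * (R powr y * exp (- (R + 1))) \<le> indicator {0<..} t * (t powr y * exp (- t))" for t
    using assms by (auto simp: indicator_def powr_mono2 intro!: mult_mono)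
  with 1 2 show ?thesis
    using integral_mono[of lborel "\<lambda>t. indicator {R..R + 1} t * (R powr y * exp (- (R + 1)))" "\<lambda>t. indicator {0<..} t * (t powr y * exp (- t))"]
    by (auto simp: has_bochner_integral_iff)
qed

section \<open>Power series in a fractional power of time\<close>

text \<open>
  With these Gamma factors the Mittag-Leffler function of order \<open>\<nu>\<close> at \<open>x * t powr \<nu>\<close> is the case
  \<open>a m = x ^ m\<close>. The power \<open>(t powr \<nu>) ^ m\<close> is used in place of \<open>t powr (\<nu> * m)\<close> because
  \<open>0 powr 0 = 0\<close>, which would lose the constant term at \<open>t = 0\<close>.
\<close>

definition frac_series :: "real \<Rightarrow> (nat \<Rightarrow> real) \<Rightarrow> real \<Rightarrow> real" where
  "frac_series \<nu> a t = (\<Sum>m. a m / Gamma (\<nu> * real m + 1) * (t powr \<nu>) ^ m)"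

lemma Gamma_affine_pos: "\<nu> > 0 \<Longrightarrow> Gamma (\<nu> * real m + 1) > (0::real)"
  by (intro Gamma_real_pos) (auto intro!: add_nonneg_pos)

text \<open>
  Choosing \<open>R\<close> in \<open>Gamma_lower_bound\<close> with \<open>R powr \<nu> > 2 * C * \<bar>x\<bar>\<close> bounds the series by a geometric
  one.
\<close>

lemma frac_series_summable:
  fixes \<nu> K C x :: real
  assumes "\<nu> > 0" "C > 0" "\<And>m. \<bar>a m\<bar> \<le> K * C ^ m"
  shows "summable (\<lambda>m. \<bar>a m / Gamma (\<nu> * real m + 1) * x ^ m\<bar>)"
proof -
  \<comment> \<open>The summand 1 keeps D positive at x = 0.\<close>
  define D where "D = 2 * C * \<bar>x\<bar> + 1"
  define R where "R = D powr (1 / \<nu>)"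
  have D: "D > 0" using assms by (auto simp: D_def intro!: add_nonneg_pos)
  have R: "R > 0" "R powr \<nu> = D" using assms D by (auto simp: R_def powr_powr)
  have K: "K \<ge> 0" using assms(3)[of 0] by simp
  have bound: "\<bar>a m / Gamma (\<nu> * real m + 1) * x ^ m\<bar> \<le> K * exp (R + 1) * (C * \<bar>x\<bar> / D) ^ m" for m
  proof -
    have "R powr (\<nu> * real m) = D ^ m"
      using R D by (simp add: powr_powr[symmetric] powr_realpow)
    then have G: "D ^ m * exp (- (R + 1)) \<le> Gamma (\<nu> * real m + 1)"
      using Gamma_lower_bound[of "\<nu> * real m" R] assms R by simp
    have "\<bar>a m / Gamma (\<nu> * real m + 1) * x ^ m\<bar> = \<bar>a m\<bar> * \<bar>x\<bar> ^ m / Gamma (\<nu> * real m + 1)"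
      using Gamma_affine_pos[OF assms(1), of m] by (simp add: abs_mult power_abs)
    also have "\<dots> \<le> (K * C ^ m) * \<bar>x\<bar> ^ m / (D ^ m * exp (- (R + 1)))"
      using G D assms(3)[of m] assms(2) K
      by (intro frac_le mult_right_mono) (auto intro!: mult_nonneg_nonneg)
    also have "\<dots> = K * exp (R + 1) * (C * \<bar>x\<bar> / D) ^ m"
      unfolding exp_minus by (simp add: power_divide power_mult_distrib field_simps)
    finally show ?thesis .
  qed
  have "\<bar>C * \<bar>x\<bar> / D\<bar> < 1"
    using D assms by (simp add: D_def abs_mult add_nonneg_pos)
  then have "summable (\<lambda>m. K * exp (R + 1) * (C * \<bar>x\<bar> / D) ^ m)"
    by (intro summable_mult summable_geometric) auto
  then show ?thesis
    by (rule summable_comparison_test') (use bound in auto)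
qed

lemma shifted_bound:
  fixes K C :: real
  assumes "\<And>m. \<bar>a m\<bar> \<le> K * C ^ m"
  shows "\<bar>a (m + j)\<bar> \<le> (K * C ^ j) * C ^ m"
  using assms[of "m + j"] by (simp add: power_add mult_ac)

lemma frac_series_has_derivative:
  fixes \<nu> K C t :: real
  assumes "\<nu> > 0" "C > 0" "\<And>m. \<bar>a m\<bar> \<le> K * C ^ m" "t > 0"
  shows "(frac_series \<nu> a has_field_derivative
           (\<Sum>m. a (Suc m) / Gamma (\<nu> * real (Suc m)) * t powr (\<nu> * real (Suc m) - 1))) (at t)"
proof -
  define c where "c m = a m / Gamma (\<nu> * real m + 1)" for m
  have sm: "summable (\<lambda>n. c n * y ^ n)" for y
    using frac_series_summable[OF assms(1-3), of y] by (auto simp: c_def intro: summable_rabs_cancel)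
  have P: "((\<lambda>x. \<Sum>n. c n * x ^ n) has_field_derivative (\<Sum>n. diffs c n * x ^ n)) (at x)" for x
    by (rule termdiffs_strong_converges_everywhere) (rule sm)
  have "((\<lambda>t. \<Sum>n. c n * (t powr \<nu>) ^ n) has_field_derivative
      (\<Sum>n. diffs c n * (t powr \<nu>) ^ n) * (\<nu> * t powr (\<nu> - 1))) (at t)"
    using assms(4) by (intro DERIV_chain2[OF P]) (auto intro!: derivative_eq_intros)
  also have "(\<lambda>t. \<Sum>n. c n * (t powr \<nu>) ^ n) = frac_series \<nu> a"
    by (simp add: fun_eq_iff frac_series_def c_def)
  also have "(\<Sum>n. diffs c n * (t powr \<nu>) ^ n) * (\<nu> * t powr (\<nu> - 1)) =
      (\<Sum>n. diffs c n * (t powr \<nu>) ^ n * (\<nu> * t powr (\<nu> - 1)))"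
    by (rule suminf_mult2) (rule termdiff_converges_all[OF sm])
  also have "(\<lambda>n. diffs c n * (t powr \<nu>) ^ n * (\<nu> * t powr (\<nu> - 1))) =
      (\<lambda>m. a (Suc m) / Gamma (\<nu> * real (Suc m)) * t powr (\<nu> * real (Suc m) - 1))"
  proof
    fix m
    have pos: "\<nu> * real (Suc m) > 0" using assms by simp
    have "Gamma (\<nu> * real (Suc m) + 1) = \<nu> * real (Suc m) * Gamma (\<nu> * real (Suc m))"
      using pos by (intro Gamma_plus1) (auto simp: nonpos_Ints_def)
    moreover have "(t powr \<nu>) ^ m * t powr (\<nu> - 1) = t powr (\<nu> * real (Suc m) - 1)"
      using assms by (simp add: powr_realpow[symmetric] powr_powr powr_add[symmetric] algebra_simps)
    ultimately show "diffs c m * (t powr \<nu>) ^ m * (\<nu> * t powr (\<nu> - 1)) =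
       a (Suc m) / Gamma (\<nu> * real (Suc m)) * t powr (\<nu> * real (Suc m) - 1)"
      using pos by (simp add: diffs_def c_def del: of_nat_Suc)
  qed
  finally show ?thesis .
qed

lemma frac_series_continuous:
  fixes \<nu> K C :: real
  assumes "\<nu> > 0" "C > 0" "\<And>m. \<bar>a m\<bar> \<le> K * C ^ m"
  shows "continuous_on {0..} (frac_series \<nu> a)"
proof -
  define c where "c m = a m / Gamma (\<nu> * real m + 1)" for m
  have sm: "summable (\<lambda>n. c n * y ^ n)" for y
    using frac_series_summable[OF assms(1-3), of y] by (auto simp: c_def intro: summable_rabs_cancel)
  have P: "isCont (\<lambda>x. \<Sum>n. c n * x ^ n) x" for x
    by (rule DERIV_isCont, rule termdiffs_strong_converges_everywhere) (rule sm)
  have "continuous_on {0..} (\<lambda>t. t powr \<nu>)"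
    using assms(1) by (intro continuous_on_powr') auto
  then have "continuous_on {0..} (\<lambda>t. (\<Sum>n. c n * (t powr \<nu>) ^ n))"
    by (intro continuous_on_compose2[where f="\<lambda>t. t powr \<nu>" and g="\<lambda>x. \<Sum>n. c n * x ^ n" and t=UNIV])
       (auto intro: continuous_at_imp_continuous_on P)
  then show ?thesis
    by (simp add: frac_series_def c_def cong: continuous_on_cong)
qed

lemma frac_series_0: "frac_series \<nu> a 0 = a 0"
  using suminf_finite[of "{0}" "\<lambda>m. a m * 0 ^ m / Gamma (\<nu> * real m + 1)"] by (simp add: frac_series_def)

text \<open>
  The Caputo derivative at \<open>t\<close> sees only the values on \<open>[0, t]\<close> and near \<open>t\<close>, and \<open>deriv\<close> at positive
  times is local.
\<close>

lemma caputo_cong: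
  assumes "t > 0" and eq: "\<And>s. s \<ge> 0 \<Longrightarrow> u s = v s"
  shows "caputo_deriv \<beta> u t = caputo_deriv \<beta> v t" "caputo_differentiable \<beta> u t \<longleftrightarrow> caputo_differentiable \<beta> v t"
proof -
  have ev: "eventually (\<lambda>x. u x = v x) (nhds s)" if "s > 0" for s
  proof -
    have "eventually (\<lambda>x. x \<in> {0<..}) (nhds s)" using that by (intro eventually_nhds_in_open) auto
    then show ?thesis by eventually_elim (use eq in auto)
  qed
  have d: "deriv u s = deriv v s" if "s > 0" for s
    by (rule deriv_cong_ev[OF ev[OF that] refl])
  have fd: "u field_differentiable at s \<longleftrightarrow> v field_differentiable at s" if "s > 0" for s
    unfolding field_differentiable_def using DERIV_cong_ev[OF refl ev[OF that] refl] by blast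
  have "(\<lambda>s. indicator {0<..<t} s *\<^sub>R (deriv u s / (t - s) powr \<beta>)) = (\<lambda>s. indicator {0<..<t} s *\<^sub>R (deriv v s / (t - s) powr \<beta>))"
    using d by (auto simp: fun_eq_iff indicator_def)
  moreover have "continuous_on {0..t} u \<longleftrightarrow> continuous_on {0..t} v"
    using eq by (intro continuous_on_cong) auto
  ultimately show "caputo_deriv \<beta> u t = caputo_deriv \<beta> v t" "caputo_differentiable \<beta> u t \<longleftrightarrow> caputo_differentiable \<beta> v t"
    using assms(1) d fd
    by (auto simp: caputo_deriv_def caputo_differentiable_def set_integrable_def set_lebesgue_integral_def)
qed

lemma abs_mult_eq_sgn:
  fixes c g :: real
  assumes "g \<ge> 0"
  shows "\<bar>c * g\<bar> = sgn c * (c * g)"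
  using assms by (simp add: abs_mult sgn_if)

text \<open>
  Term by term, the Beta integral sends \<open>s powr (\<nu> * n - 1) / Gamma (\<nu> * n)\<close> to
  \<open>Gamma (1 - \<beta>) * t powr (\<nu> * n - \<beta>) / Gamma (\<nu> * n - \<beta> + 1)\<close>, which for \<open>\<beta> = \<nu> * j\<close> is the
  basis function of index \<open>n - j\<close>. The terms with \<open>0 < n < j\<close> would produce negative powers of \<open>t\<close>,
  hence the last hypothesis; the constant term is killed by the derivative inside the integral. The
  exchange of sum and integral is justified because the integrals of the absolute values are the
  terms of an absolutely convergent series of the same kind.
\<close>

lemma caputo_frac_series_order_less_1:
  fixes \<nu> \<beta> K C t :: real and j :: nat
  assumes "\<nu> > 0" "C > 0" "\<And>m. \<bar>a m\<bar> \<le> K * C ^ m" "t > 0"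
    and "0 < j" "\<beta> = \<nu> * real j" "\<beta> < 1" "\<And>i. 0 < i \<Longrightarrow> i < j \<Longrightarrow> a i = 0"
  shows "caputo_differentiable \<beta> (frac_series \<nu> a) t"
    and "caputo_deriv \<beta> (frac_series \<nu> a) t = frac_series \<nu> (\<lambda>m. a (m + j)) t"
proof -
  define f where "f m s = a (Suc m) / Gamma (\<nu> * real (Suc m)) *
      (indicator {0<..<t} s * (s powr (\<nu> * real (Suc m) - 1) * (t - s) powr ((1 - \<beta>) - 1)))" for m s
  define I where "I m = a (Suc m) / Gamma (\<nu> * real (Suc m)) *
      (Beta (\<nu> * real (Suc m)) (1 - \<beta>) * t powr (\<nu> * real (Suc m) + (1 - \<beta>) - 1))" for m
  define b where "b m = a (m + j) / Gamma (\<nu> * real m + 1) * (t powr \<nu>) ^ m" for m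
  have pos: "\<nu> * real (Suc m) > 0" for m using assms(1) by simp
  have Gpos: "Gamma (\<nu> * real (Suc m)) > 0" for m using pos by (rule Gamma_real_pos)
  have G1: "Gamma (1 - \<beta>) \<noteq> 0" using assms(7) by (metis Gamma_real_pos diff_gt_0_iff_gt less_irrefl)
  have bf: "has_bochner_integral lborel (f m) (I m)" for m
    unfolding f_def I_def using pos assms
    by (intro has_bochner_integral_mult_right Beta_integral_scaled) auto
  \<comment> \<open>The series of the derivative starts at the coefficient of index 1, so an index m here stands for a (Suc m).\<close>
  have I_zero: "I m = 0" if "m < j - 1" for m
    using assms(8)[of "Suc m"] that by (simp add: I_def)
  have I_shift: "I (m + (j - 1)) = Gamma (1 - \<beta>) * b m" for m
  proof -
    have e: "\<nu> * real (Suc (m + (j - 1))) = \<nu> * real m + \<beta>"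
      using assms(5,6) by (simp add: of_nat_diff algebra_simps)
    have "Suc (m + (j - 1)) = m + j" using assms(5) by simp
    moreover have "t powr (\<nu> * real m + \<beta> + (1 - \<beta>) - 1) = (t powr \<nu>) ^ m"
      using assms(4) by (simp add: powr_realpow[symmetric] powr_powr)
    ultimately show ?thesis
      using Gpos[of "m + (j - 1)"] unfolding I_def e by (simp add: Beta_def b_def)
  qed
  have sb: "summable (\<lambda>m. \<bar>b m\<bar>)"
    unfolding b_def using frac_series_summable[OF assms(1,2) shifted_bound[of a K C, OF assms(3)]] .
  have norm_int: "(\<integral>s. norm (f m s) \<partial>lborel) = \<bar>I m\<bar>" for m
  proof -
    have "norm (f m s) = sgn (a (Suc m)) * f m s" for s
      using abs_mult_eq_sgn[of "f m s / a (Suc m)" "a (Suc m)"] Gpos[of m]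
      by (cases "a (Suc m) = 0") (simp_all add: f_def indicator_def)
    then have "(\<integral>s. norm (f m s) \<partial>lborel) = sgn (a (Suc m)) * I m"
      using bf[of m] by (simp add: has_bochner_integral_iff)
    also have "\<dots> = \<bar>I m\<bar>"
    proof -
      have "Beta (\<nu> * real (Suc m)) (1 - \<beta>) \<ge> 0"
        unfolding Beta_def using pos[of m] assms(7)
        by (intro divide_nonneg_nonneg mult_nonneg_nonneg less_imp_le Gamma_real_pos) auto
      then have "Beta (\<nu> * real (Suc m)) (1 - \<beta>) * t powr (\<nu> * real (Suc m) + (1 - \<beta>) - 1)
          / Gamma (\<nu> * real (Suc m)) \<ge> 0"
        using Gpos[of m] by (intro divide_nonneg_nonneg mult_nonneg_nonneg) auto
      from abs_mult_eq_sgn[OF this, of "a (Suc m)"] show ?thesis by (simp add: I_def)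
    qed
    finally show ?thesis .
  qed
  have "summable (\<lambda>m. \<bar>I (m + (j - 1))\<bar>)"
    unfolding I_shift abs_mult by (intro summable_mult sb)
  then have sI: "summable (\<lambda>m. \<bar>I m\<bar>)" by (subst (asm) summable_iff_shift)
  have sumI: "(\<Sum>m. I m) = Gamma (1 - \<beta>) * (\<Sum>m. b m)"
  proof -
    have "(\<Sum>m. I m) = (\<Sum>m. I (m + (j - 1))) + (\<Sum>m<j - 1. I m)"
      by (rule suminf_split_initial_segment) (rule summable_rabs_cancel[OF sI])
    also have "(\<Sum>m<j - 1. I m) = 0" using I_zero by simp
    also have "(\<Sum>m. I (m + (j - 1))) = Gamma (1 - \<beta>) * (\<Sum>m. b m)"
      unfolding I_shift by (rule suminf_mult) (rule summable_rabs_cancel[OF sb])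
    finally show ?thesis by simp
  qed
  have sf: "summable (\<lambda>m. norm (f m s))" for s
  proof (cases "s \<in> {0<..<t}")
    case True
    let ?d = "\<lambda>m. diffs (\<lambda>m. \<bar>a m\<bar> / Gamma (\<nu> * real m + 1)) m * (s powr \<nu>) ^ m"
    have "summable ?d"
    proof (rule termdiff_converges_all)
      fix y :: real
      show "summable (\<lambda>n. \<bar>a n\<bar> / Gamma (\<nu> * real n + 1) * y ^ n)"
        by (rule summable_rabs_cancel)
          (use frac_series_summable[of \<nu> C "\<lambda>n. \<bar>a n\<bar>" K y] assms(1-3) in auto)
    qed
    then have "summable (\<lambda>m. ?d m * (\<nu> * s powr (\<nu> - 1) * (t - s) powr (- \<beta>)))"
      by (rule summable_mult2)
    also have "(\<lambda>m. ?d m * (\<nu> * s powr (\<nu> - 1) * (t - s) powr (- \<beta>))) = (\<lambda>m. norm (f m s))"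
    proof
      fix m
      have "Gamma (\<nu> * real (Suc m) + 1) = \<nu> * real (Suc m) * Gamma (\<nu> * real (Suc m))"
        using pos[of m] by (intro Gamma_plus1) (auto simp: nonpos_Ints_def)
      moreover have "(s powr \<nu>) ^ m * s powr (\<nu> - 1) = s powr (\<nu> * real (Suc m) - 1)"
        using True by (simp add: powr_realpow[symmetric] powr_powr powr_add[symmetric] algebra_simps)
      ultimately show "?d m * (\<nu> * s powr (\<nu> - 1) * (t - s) powr (- \<beta>)) = norm (f m s)"
        using pos[of m] Gpos[of m] True by (simp add: diffs_def f_def abs_mult del: of_nat_Suc)
    qed
    finally show ?thesis .
  qed (simp add: f_def)
  have fi: "integrable lborel (f m)" and fI: "(\<integral>s. f m s \<partial>lborel) = I m" for m
    using bf[of m] by (auto simp: has_bochner_integral_iff)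
  have sN: "summable (\<lambda>m. \<integral>s. norm (f m s) \<partial>lborel)" using sI unfolding norm_int .
  have int_sum: "integrable lborel (\<lambda>s. \<Sum>m. f m s)" "(\<integral>s. (\<Sum>m. f m s) \<partial>lborel) = (\<Sum>m. I m)"
    using integrable_suminf[OF fi _ sN] integral_suminf[OF fi _ sN] sf fI by auto
  have der: "(frac_series \<nu> a has_field_derivative
      (\<Sum>m. a (Suc m) / Gamma (\<nu> * real (Suc m)) * s powr (\<nu> * real (Suc m) - 1))) (at s)" if "s > 0" for s
    using assms(1-3) that by (rule frac_series_has_derivative)
  have eq: "indicator {0<..<t} s *\<^sub>R (deriv (frac_series \<nu> a) s / (t - s) powr \<beta>) = (\<Sum>m. f m s)" for s
  proof (cases "s \<in> {0<..<t}")
    case True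
    have "summable (\<lambda>m. f m s)" using sf[of s] by (rule summable_norm_cancel)
    then have *: "summable (\<lambda>m. f m s * (t - s) powr \<beta>)" by (rule summable_mult2)
    have "f m s * (t - s) powr \<beta> = a (Suc m) / Gamma (\<nu> * real (Suc m)) * s powr (\<nu> * real (Suc m) - 1)" for m
      using True by (simp add: f_def powr_minus field_simps)
    with * have "summable (\<lambda>m. a (Suc m) / Gamma (\<nu> * real (Suc m)) * s powr (\<nu> * real (Suc m) - 1))"
      by simp
    from suminf_divide[OF this, of "(t - s) powr \<beta>"] DERIV_imp_deriv[OF der[of s]] True
    show ?thesis by (simp add: f_def powr_minus field_simps)
  qed (simp add: f_def)
  show "caputo_deriv \<beta> (frac_series \<nu> a) t = frac_series \<nu> (\<lambda>m. a (m + j)) t"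
    using assms(7) G1 unfolding caputo_deriv_def set_lebesgue_integral_def eq int_sum(2) sumI
    by (simp add: frac_series_def b_def[abs_def])
  have "continuous_on {0..t} (frac_series \<nu> a)"
    using frac_series_continuous[OF assms(1-3)] by (rule continuous_on_subset) auto
  moreover have "\<forall>s\<in>{0<..<t}. frac_series \<nu> a field_differentiable at s"
    unfolding field_differentiable_def by (blast intro: der[OF greaterThanLessThan_iff[THEN iffD1, THEN conjunct1]])
  ultimately show "caputo_differentiable \<beta> (frac_series \<nu> a) t"
    using assms(7) int_sum(1) unfolding caputo_differentiable_def set_integrable_def eq by simp
qed

text \<open>
  In the limiting order 1 no integral is left, and the shift is the reindexing of the derivative series.
\<close>

lemma caputo_frac_series_order_1:
  fixes \<nu> K C t :: real and j :: nat
  assumes "\<nu> > 0" "C > 0" "\<And>m. \<bar>a m\<bar> \<le> K * C ^ m" "t > 0"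
    and "0 < j" "\<nu> * real j = 1" "\<And>i. 0 < i \<Longrightarrow> i < j \<Longrightarrow> a i = 0"
  shows "caputo_differentiable 1 (frac_series \<nu> a) t"
    and "caputo_deriv 1 (frac_series \<nu> a) t = frac_series \<nu> (\<lambda>m. a (m + j)) t"
proof -
  note der = frac_series_has_derivative[OF assms(1-4)]
  show "caputo_differentiable 1 (frac_series \<nu> a) t"
    using der by (auto simp: caputo_differentiable_def field_differentiable_def)
  define g where "g m = a (Suc m) / Gamma (\<nu> * real (Suc m)) * t powr (\<nu> * real (Suc m) - 1)" for m
  define b where "b m = a (m + j) / Gamma (\<nu> * real m + 1) * (t powr \<nu>) ^ m" for m
  have g_zero: "g m = 0" if "m < j - 1" for m
    using assms(7)[of "Suc m"] that by (simp add: g_def)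
  have g_shift: "g (m + (j - 1)) = b m" for m
  proof -
    have e: "\<nu> * real (Suc (m + (j - 1))) = \<nu> * real m + 1"
      using assms(5,6) by (simp add: of_nat_diff algebra_simps)
    have "Suc (m + (j - 1)) = m + j" using assms(5) by simp
    moreover have "t powr (\<nu> * real m + 1 - 1) = (t powr \<nu>) ^ m"
      using assms(4) by (simp add: powr_realpow[symmetric] powr_powr)
    ultimately show ?thesis unfolding g_def e by (simp add: b_def)
  qed
  have sb: "summable (\<lambda>m. \<bar>b m\<bar>)"
    unfolding b_def using frac_series_summable[OF assms(1,2) shifted_bound[of a K C, OF assms(3)]] .
  then have "summable (\<lambda>m. g (m + (j - 1)))" unfolding g_shift by (rule summable_rabs_cancel)
  then have "summable g" by (subst (asm) summable_iff_shift)
  then have "(\<Sum>m. g m) = (\<Sum>m. g (m + (j - 1))) + (\<Sum>m<j - 1. g m)"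
    by (rule suminf_split_initial_segment)
  then have "(\<Sum>m. g m) = (\<Sum>m. b m)" using g_zero unfolding g_shift by simp
  with DERIV_imp_deriv[OF der]
  show "caputo_deriv 1 (frac_series \<nu> a) t = frac_series \<nu> (\<lambda>m. a (m + j)) t"
    by (simp add: caputo_deriv_def frac_series_def b_def g_def)
qed

lemma caputo_frac_series:
  fixes \<nu> K C t :: real and j :: nat
  assumes "\<nu> > 0" "C > 0" "\<And>m. \<bar>a m\<bar> \<le> K * C ^ m" "t > 0"
    and "0 < j" "\<nu> * real j \<le> 1" "\<And>i. 0 < i \<Longrightarrow> i < j \<Longrightarrow> a i = 0"
  shows "caputo_differentiable (\<nu> * real j) (frac_series \<nu> a) t \<and>
    caputo_deriv (\<nu> * real j) (frac_series \<nu> a) t = frac_series \<nu> (\<lambda>m. a (m + j)) t"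
proof (cases "\<nu> * real j = 1")
  case True
  show ?thesis unfolding True
    using caputo_frac_series_order_1[OF assms(1-5) True assms(7)] by blast
next
  case False
  then show ?thesis
    using caputo_frac_series_order_less_1[OF assms(1-5) refl _ assms(7)] assms(6) by simp
qed

text \<open>
  Each term is a Gamma integral, and the Gamma factor cancels. What remains is a power series in
  \<open>1 / \<mu> powr \<nu>\<close> with coefficients \<open>a m\<close>, so \<open>\<mu>\<close> must be large against their growth rate.
\<close>

lemma frac_series_laplace:
  fixes \<nu> K C \<mu> :: real
  assumes "\<nu> > 0" "C > 0" "\<And>m. \<bar>a m\<bar> \<le> K * C ^ m" "\<mu> > 0" "C < \<mu> powr \<nu>"
  shows "integrable lborel (\<lambda>t. indicator {0<..} t * (exp (- \<mu> * t) * frac_series \<nu> a t))"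
    and "(\<lambda>m. a m / (\<mu> powr \<nu>) ^ m / \<mu>) sums
           (\<integral>t. indicator {0<..} t * (exp (- \<mu> * t) * frac_series \<nu> a t) \<partial>lborel)"
proof -
  define f where "f m t = a m / Gamma (\<nu> * real m + 1) *
     (indicator {0<..} t * (t powr ((\<nu> * real m + 1) - 1) * exp (- \<mu> * t)))" for m t
  define I where "I m = a m / (\<mu> powr \<nu>) ^ m / \<mu>" for m
  have Gpos: "Gamma (\<nu> * real m + 1) > 0" for m using assms(1) by (rule Gamma_affine_pos)
  have bf: "has_bochner_integral lborel (f m) (I m)" for m
  proof -
    have "\<nu> * real m + 1 > 0" using assms(1) by (intro add_nonneg_pos) auto
    then have "has_bochner_integral lborel (f m)
       (a m / Gamma (\<nu> * real m + 1) * (Gamma (\<nu> * real m + 1) / \<mu> powr (\<nu> * real m + 1)))"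
      unfolding f_def using assms(4) by (intro has_bochner_integral_mult_right Gamma_integral_exp)
    also have "a m / Gamma (\<nu> * real m + 1) * (Gamma (\<nu> * real m + 1) / \<mu> powr (\<nu> * real m + 1)) = I m"
      using Gpos[of m] assms(4) by (simp add: I_def powr_add powr_realpow[symmetric] powr_powr)
    finally show ?thesis .
  qed
  have norm_int: "(\<integral>s. norm (f m s) \<partial>lborel) = \<bar>I m\<bar>" for m
  proof -
    have "norm (f m s) = sgn (a m) * f m s" for s
      using abs_mult_eq_sgn[of "f m s / a m" "a m"] Gpos[of m]
      by (cases "a m = 0") (simp_all add: f_def indicator_def)
    then have "(\<integral>s. norm (f m s) \<partial>lborel) = sgn (a m) * I m"
      using bf[of m] by (simp add: has_bochner_integral_iff)
    also have "\<dots> = \<bar>I m\<bar>"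
      using assms by (simp add: I_def abs_mult abs_sgn mult_ac)
    finally show ?thesis .
  qed
  have sI: "summable (\<lambda>m. \<bar>I m\<bar>)"
  proof (rule summable_comparison_test')
    show "summable (\<lambda>m. K / \<mu> * (C / \<mu> powr \<nu>) ^ m)"
      using assms by (intro summable_mult summable_geometric) auto
    show "norm \<bar>I m\<bar> \<le> K / \<mu> * (C / \<mu> powr \<nu>) ^ m" if "m \<ge> 0" for m
      using divide_right_mono[OF assms(3)[of m], of "(\<mu> powr \<nu>) ^ m * \<mu>"] assms(4)
      by (simp add: I_def power_divide abs_mult mult_ac)
  qed
  have f_eq: "f m t = indicator {0<..} t * exp (- \<mu> * t) * (a m / Gamma (\<nu> * real m + 1) * (t powr \<nu>) ^ m)" for m t
    by (simp add: f_def powr_realpow[symmetric] powr_powr indicator_def)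
  have sa: "summable (\<lambda>m. \<bar>a m / Gamma (\<nu> * real m + 1) * (t powr \<nu>) ^ m\<bar>)" for t
    using assms(1-3) by (rule frac_series_summable)
  have sf: "summable (\<lambda>m. norm (f m t))" for t
    unfolding f_eq norm_mult real_norm_def[symmetric] using sa[of t]
    by (intro summable_mult) (simp add: abs_mult)
  have eq: "(\<Sum>m. f m t) = indicator {0<..} t * (exp (- \<mu> * t) * frac_series \<nu> a t)" for t
    unfolding f_eq frac_series_def using summable_rabs_cancel[OF sa] by (subst suminf_mult) auto
  have fi: "integrable lborel (f m)" and fI: "(\<integral>s. f m s \<partial>lborel) = I m" for m
    using bf[of m] by (auto simp: has_bochner_integral_iff)
  have sN: "summable (\<lambda>m. \<integral>s. norm (f m s) \<partial>lborel)" using sI unfolding norm_int .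
  show "integrable lborel (\<lambda>t. indicator {0<..} t * (exp (- \<mu> * t) * frac_series \<nu> a t))"
    using integrable_suminf[OF fi _ sN] sf unfolding eq by simp
  show "(\<lambda>m. a m / (\<mu> powr \<nu>) ^ m / \<mu>) sums
           (\<integral>t. indicator {0<..} t * (exp (- \<mu> * t) * frac_series \<nu> a t) \<partial>lborel)"
    using sums_integral[OF fi _ sN] sf unfolding eq fI I_def by simp
qed

section \<open>The series solution of the fractional difference-differential equation\<close>

text \<open>
  The equation for the state probabilities, read off coefficientwise: differentiation of orders
  \<open>2 * \<nu>\<close> and \<open>\<nu>\<close> shifts the index by 2 and by 1. The coefficient of index 1 must be 0, since the
  derivative of order \<open>2 * \<nu>\<close> of \<open>t powr \<nu>\<close> is a multiple of \<open>t powr (- \<nu>)\<close>, which nothing else in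
  the equation could cancel.
\<close>

fun state_coeff :: "real \<Rightarrow> real \<Rightarrow> nat \<Rightarrow> nat \<Rightarrow> real" where
  "state_coeff l \<Lambda> k 0 = (if k = 0 then 1 else 0)"
| "state_coeff l \<Lambda> k (Suc 0) = 0"
| "state_coeff l \<Lambda> k (Suc (Suc m)) = - 2 * l * state_coeff l \<Lambda> k (Suc m)
     - \<Lambda> * (state_coeff l \<Lambda> k m - (if k = 0 then 0 else state_coeff l \<Lambda> (k - 1) m))"

lemma state_coeff_bound:
  assumes "l > 0" "\<Lambda> > 0"
  shows "\<bar>state_coeff l \<Lambda> k m\<bar> \<le> 1 * (2 * l + 2 * \<Lambda> + 1) ^ m"
proof -
  define C where "C = 2 * l + 2 * \<Lambda> + 1"
  have C: "C \<ge> 1" using assms by (simp add: C_def)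
  have "\<forall>k. \<bar>state_coeff l \<Lambda> k m\<bar> \<le> C ^ m"
  proof (induction m rule: less_induct)
    case (less m)
    show ?case
    proof
      fix k
      consider "m = 0" | "m = 1" | n where "m = Suc (Suc n)"
        by (metis One_nat_def not0_implies_Suc)
      then show "\<bar>state_coeff l \<Lambda> k m\<bar> \<le> C ^ m"
      proof cases
        case 3
        have 1: "\<bar>state_coeff l \<Lambda> k (Suc n)\<bar> \<le> C ^ Suc n" "\<And>k. \<bar>state_coeff l \<Lambda> k n\<bar> \<le> C ^ n"
          using less.IH[of "Suc n"] less.IH[of n] 3 by (auto simp del: power_Suc)
        have "\<bar>state_coeff l \<Lambda> k n - (if k = 0 then 0 else state_coeff l \<Lambda> (k - 1) n)\<bar> \<le> 2 * C ^ n"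
          using 1(2)[of k] 1(2)[of "k - 1"] by auto
        then have 2: "\<bar>\<Lambda> * (state_coeff l \<Lambda> k n - (if k = 0 then 0 else state_coeff l \<Lambda> (k - 1) n))\<bar> \<le> \<Lambda> * (2 * C ^ n)"
          unfolding abs_mult using assms by simp
        have 3: "\<bar>2 * l * state_coeff l \<Lambda> k (Suc n)\<bar> \<le> 2 * l * C ^ Suc n"
          unfolding abs_mult using assms 1 by simp
        have "\<bar>state_coeff l \<Lambda> k m\<bar> \<le> 2 * l * C ^ Suc n + \<Lambda> * (2 * C ^ n)"
          using 2 3 \<open>m = _\<close> by simp
        also have "\<dots> \<le> 2 * l * C ^ Suc n + 2 * \<Lambda> * C ^ Suc n"
          using C assms by simp
        also have "\<dots> \<le> C * C ^ Suc n"
          using C by (subst distrib_right[symmetric], intro mult_right_mono) (auto simp: C_def)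
        finally show ?thesis using \<open>m = _\<close> by simp
      qed (use C in auto)
    qed
  qed
  then show ?thesis by (simp add: C_def)
qed

lemma frac_series_lincomb:
  fixes \<nu> C K K' x y t :: real
  assumes "\<nu> > 0" "C > 0" "\<And>m. \<bar>a m\<bar> \<le> K * C ^ m" "\<And>m. \<bar>b m\<bar> \<le> K' * C ^ m"
  shows "frac_series \<nu> (\<lambda>m. x * a m + y * b m) t = x * frac_series \<nu> a t + y * frac_series \<nu> b t"
proof -
  have a: "summable (\<lambda>m. a m / Gamma (\<nu> * real m + 1) * (t powr \<nu>) ^ m)"
    and b: "summable (\<lambda>m. b m / Gamma (\<nu> * real m + 1) * (t powr \<nu>) ^ m)"
    using frac_series_summable[OF assms(1-3)] frac_series_summable[OF assms(1,2,4)]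
    by (auto intro: summable_rabs_cancel)
  have "(\<lambda>m. x * (a m / Gamma (\<nu> * real m + 1) * (t powr \<nu>) ^ m) + y * (b m / Gamma (\<nu> * real m + 1) * (t powr \<nu>) ^ m))
    sums (x * frac_series \<nu> a t + y * frac_series \<nu> b t)"
    unfolding frac_series_def by (intro sums_add sums_mult summable_sums a b)
  then show ?thesis
    unfolding frac_series_def by (intro sums_unique[symmetric]) (simp add: algebra_simps add_divide_distrib)
qed

lemma state_series_equation:
  fixes \<nu> l \<Lambda> t :: real
  assumes "0 < \<nu>" "\<nu> \<le> 1 / 2" "l > 0" "\<Lambda> > 0" "t > 0"
  defines "q \<equiv> \<lambda>k. frac_series \<nu> (state_coeff l \<Lambda> k)"
  shows "caputo_differentiable (2 * \<nu>) (q k) t" "caputo_differentiable \<nu> (q k) t"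
    and "caputo_deriv (2 * \<nu>) (q k) t + 2 * l * caputo_deriv \<nu> (q k) t
          = - \<Lambda> * (q k t - (if k = 0 then 0 else q (k - 1) t))"
proof -
  define C where "C = 2 * l + 2 * \<Lambda> + 1"
  have C: "C > 0" using assms by (simp add: C_def add_pos_pos)
  have bd: "\<bar>state_coeff l \<Lambda> k m\<bar> \<le> 1 * C ^ m" for k m
    unfolding C_def using assms by (intro state_coeff_bound)
  have c2: "caputo_differentiable (2 * \<nu>) (q k) t \<and>
      caputo_deriv (2 * \<nu>) (q k) t = frac_series \<nu> (\<lambda>m. state_coeff l \<Lambda> k (m + 2)) t"
    using caputo_frac_series[OF assms(1) C bd assms(5), of 2] assms(2)
    unfolding q_def by (auto simp: less_2_cases_iff mult.commute)
  have c1: "caputo_differentiable \<nu> (q k) t \<and>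
      caputo_deriv \<nu> (q k) t = frac_series \<nu> (\<lambda>m. state_coeff l \<Lambda> k (m + 1)) t"
    using caputo_frac_series[OF assms(1) C bd assms(5), of 1] assms(2)
    unfolding q_def by auto
  show "caputo_differentiable (2 * \<nu>) (q k) t" "caputo_differentiable \<nu> (q k) t"
    using c1 c2 by auto
  define d where "d = (\<lambda>m. if k = 0 then 0 else state_coeff l \<Lambda> (k - 1) m)"
  have bd': "\<bar>d m\<bar> \<le> 1 * C ^ m" for m using bd[of "k - 1" m] C by (simp add: d_def)
  have fd: "frac_series \<nu> d t = (if k = 0 then 0 else q (k - 1) t)"
    by (simp add: d_def q_def frac_series_def)
  note sh = shifted_bound[of "state_coeff l \<Lambda> k" 1 C, OF bd]
  have "frac_series \<nu> (\<lambda>m. state_coeff l \<Lambda> k (m + 2)) t + 2 * l * frac_series \<nu> (\<lambda>m. state_coeff l \<Lambda> k (m + 1)) t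
    = frac_series \<nu> (\<lambda>m. 1 * state_coeff l \<Lambda> k (m + 2) + (2 * l) * state_coeff l \<Lambda> k (m + 1)) t"
    using frac_series_lincomb[OF assms(1) C sh sh, of 1 2 "2 * l" 1 t] by simp
  also have "(\<lambda>m. 1 * state_coeff l \<Lambda> k (m + 2) + (2 * l) * state_coeff l \<Lambda> k (m + 1)) =
      (\<lambda>m. (- \<Lambda>) * state_coeff l \<Lambda> k m + \<Lambda> * d m)"
    by (simp add: fun_eq_iff d_def algebra_simps)
  also have "frac_series \<nu> \<dots> t = (- \<Lambda>) * q k t + \<Lambda> * frac_series \<nu> d t"
    unfolding q_def by (rule frac_series_lincomb[OF assms(1) C bd bd'])
  finally show "caputo_deriv (2 * \<nu>) (q k) t + 2 * l * caputo_deriv \<nu> (q k) t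
          = - \<Lambda> * (q k t - (if k = 0 then 0 else q (k - 1) t))"
    using c1 c2 fd by (simp add: algebra_simps)
qed

text \<open>
  Multiplying the recurrence by \<open>1 / (\<mu> powr \<nu>) ^ m\<close> and summing gives
  \<open>(\<Lambda> + \<phi>) * Q k = \<phi> * \<delta> k + \<Lambda> * Q (k - 1)\<close> for the transforms \<open>Q k\<close>, where \<open>\<delta> 0 = 1 / \<mu>\<close> and
  \<open>\<delta> k = 0\<close> otherwise.
\<close>

lemma state_series_laplace:
  fixes \<nu> l \<Lambda> \<mu> :: real
  assumes "0 < \<nu>" "l > 0" "\<Lambda> > 0" "\<mu> > 0" "2 * l + 2 * \<Lambda> + 1 < \<mu> powr \<nu>"
  defines "q \<equiv> \<lambda>k. frac_series \<nu> (state_coeff l \<Lambda> k)"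
    and "\<phi> \<equiv> \<mu> powr (2 * \<nu>) + 2 * l * \<mu> powr \<nu>"
  shows "integrable lborel (\<lambda>t. indicator {0<..} t * (exp (- \<mu> * t) * q k t))"
    and "(\<integral>t. indicator {0<..} t * (exp (- \<mu> * t) * q k t) \<partial>lborel)
           = \<phi> / \<mu> * (\<Lambda> ^ k / (\<Lambda> + \<phi>) ^ Suc k)"
proof -
  define C where "C = 2 * l + 2 * \<Lambda> + 1"
  have C: "C > 0" using assms by (simp add: C_def add_pos_pos)
  have bd: "\<bar>state_coeff l \<Lambda> k m\<bar> \<le> 1 * C ^ m" for k m
    unfolding C_def using assms by (intro state_coeff_bound)
  define w where "w = \<mu> powr \<nu>"
  have w: "w > 0" using assms by (simp add: w_def)
  have wC: "C < \<mu> powr \<nu>" using assms by (simp add: C_def)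
  have \<phi>: "\<phi> = w ^ 2 + 2 * l * w" "\<phi> > 0"
    using assms by (auto simp: \<phi>_def w_def powr_powr[symmetric] powr_numeral mult.commute[of 2] intro!: add_pos_pos)
  show "integrable lborel (\<lambda>t. indicator {0<..} t * (exp (- \<mu> * t) * q k t))" for k
    unfolding q_def by (rule frac_series_laplace[OF assms(1) C bd assms(4) wC])
  define Q where "Q k = (\<integral>t. indicator {0<..} t * (exp (- \<mu> * t) * q k t) \<partial>lborel)" for k
  define S where "S k m = state_coeff l \<Lambda> k m / w ^ m / \<mu>" for k m
  have S: "S k sums Q k" for k
    unfolding Q_def q_def S_def w_def by (rule frac_series_laplace[OF assms(1) C bd assms(4) wC])
  define \<delta> where "\<delta> k = (if k = 0 then 1 / \<mu> else 0)" for k :: nat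
  have rec: "(\<Lambda> + \<phi>) * Q k = \<phi> * \<delta> k + (if k = 0 then 0 else \<Lambda> * Q (k - 1))" for k
  proof -
    have "(\<lambda>m. S k (m + 2)) sums (Q k - \<delta> k)" "(\<lambda>m. S k (m + 1)) sums (Q k - \<delta> k)"
      using S[of k] S[of 0] unfolding sums_iff_shift by (simp_all add: numeral_2_eq_2 S_def[of k 0] S_def[of k "Suc 0"] \<delta>_def)
    then have "(\<lambda>m. w ^ 2 * S k (m + 2) + 2 * l * w * S k (m + 1)) sums
        (w ^ 2 * (Q k - \<delta> k) + 2 * l * w * (Q k - \<delta> k))"
      by (intro sums_add sums_mult)
    also have "(\<lambda>m. w ^ 2 * S k (m + 2) + 2 * l * w * S k (m + 1)) =
       (\<lambda>m. - \<Lambda> * (S k m - (if k = 0 then 0 else S (k - 1) m)))"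
      using w assms(4) by (simp add: fun_eq_iff S_def power2_eq_square field_simps)
    finally have 1: "(\<lambda>m. - \<Lambda> * (S k m - (if k = 0 then 0 else S (k - 1) m))) sums
       (w ^ 2 * (Q k - \<delta> k) + 2 * l * w * (Q k - \<delta> k))" .
    have "(\<lambda>m. (if k = 0 then 0 else S (k - 1) m)) sums (if k = 0 then 0 else Q (k - 1))"
      using S[of "k - 1"] by simp
    then have "(\<lambda>m. - \<Lambda> * (S k m - (if k = 0 then 0 else S (k - 1) m))) sums
       (- \<Lambda> * (Q k - (if k = 0 then 0 else Q (k - 1))))"
      by (intro sums_mult sums_diff S)
    from sums_unique2[OF 1 this] show ?thesis by (simp add: \<phi>(1) algebra_simps split: if_splits)
  qed
  have pos: "\<Lambda> + \<phi> > 0" using \<phi> assms by simp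
  have "Q k = \<phi> / \<mu> * (\<Lambda> ^ k / (\<Lambda> + \<phi>) ^ Suc k)"
  proof (induction k)
    case 0
    have "Q 0 = \<phi> * (1 / \<mu>) / (\<Lambda> + \<phi>)"
      using rec[of 0] pos by (subst eq_divide_eq) (simp add: \<delta>_def mult.commute)
    then show ?case by simp
  next
    case (Suc k)
    have "Q (Suc k) = \<Lambda> * Q k / (\<Lambda> + \<phi>)"
      using rec[of "Suc k"] pos by (simp add: \<delta>_def field_simps)
    then show ?case using Suc by (simp add: mult_ac)
  qed
  then show "(\<integral>t. indicator {0<..} t * (exp (- \<mu> * t) * q k t) \<partial>lborel)
           = \<phi> / \<mu> * (\<Lambda> ^ k / (\<Lambda> + \<phi>) ^ Suc k)" by (simp add: Q_def)
qed

section \<open>Uniqueness for Laplace transforms of left-continuous functions\<close>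

text \<open>
  In the variable \<open>x = exp (- t)\<close> the hypotheses say that all moments of \<open>g\<close> vanish. By Weierstrass,
  \<open>f\<close> is uniformly close to a polynomial on \<open>[0, 1]\<close>.
\<close>

lemma laplace_vanishing_continuous:
  fixes g f :: "real \<Rightarrow> real"
  assumes g: "integrable lborel g" "\<And>t. t \<le> 0 \<Longrightarrow> g t = 0"
    and mom: "\<And>n::nat. integrable lborel (\<lambda>t. exp (- t) ^ n * g t)" "\<And>n::nat. (\<integral>t. exp (- t) ^ n * g t \<partial>lborel) = 0"
    and f: "continuous_on UNIV f" "\<And>x. \<bar>f x\<bar> \<le> 1"
  shows "(\<integral>t. f (exp (- t)) * g t \<partial>lborel) = 0"
proof -
  note [measurable] = borel_measurable_continuous_onI[OF f(1)] borel_measurable_integrable[OF g(1)]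
  have fint: "integrable lborel (\<lambda>t. f (exp (- t)) * g t)"
    by (rule Bochner_Integration.integrable_bound[OF g(1)]) (auto simp: abs_mult intro!: mult_left_le_one_le f(2))
  have "\<bar>\<integral>t. f (exp (- t)) * g t \<partial>lborel\<bar> \<le> e * (\<integral>t. \<bar>g t\<bar> \<partial>lborel)" if e: "e > 0" for e
  proof -
    have "continuous_on {0..1} f" using f(1) by (rule continuous_on_subset) auto
    then obtain p where p: "real_polynomial_function p" "\<And>x. x \<in> {0..1} \<Longrightarrow> \<bar>f x - p x\<bar> < e"
      using Stone_Weierstrass_real_polynomial_function[of "{0..1}" f e] e by auto
    then obtain a n where pe: "p = (\<lambda>x. \<Sum>i\<le>n. a i * x ^ i)"
      using real_polynomial_function_iff_sum by blast
    have eq: "p (exp (- t)) * g t = (\<Sum>i\<le>n. a i * (exp (- t) ^ i * g t))" for t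
      by (simp add: pe sum_distrib_right mult.assoc)
    have pint: "integrable lborel (\<lambda>t. p (exp (- t)) * g t)"
      unfolding eq by (intro Bochner_Integration.integrable_sum integrable_mult_right mom)
    have "(\<integral>t. p (exp (- t)) * g t \<partial>lborel) = (\<Sum>i\<le>n. a i * (\<integral>t. exp (- t) ^ i * g t \<partial>lborel))"
      unfolding eq by (subst Bochner_Integration.integral_sum) (auto intro!: integrable_mult_right mom)
    then have p0: "(\<integral>t. p (exp (- t)) * g t \<partial>lborel) = 0" by (simp add: mom(2))
    have "(\<integral>t. f (exp (- t)) * g t \<partial>lborel) = (\<integral>t. f (exp (- t)) * g t - p (exp (- t)) * g t \<partial>lborel)"
      using fint pint p0 by simp
    also have "\<bar>\<dots>\<bar> \<le> (\<integral>t. \<bar>f (exp (- t)) * g t - p (exp (- t)) * g t\<bar> \<partial>lborel)"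
      by (rule integral_abs_bound)
    also have "\<dots> \<le> (\<integral>t. e * \<bar>g t\<bar> \<partial>lborel)"
    proof (rule integral_mono)
      show "integrable lborel (\<lambda>t. \<bar>f (exp (- t)) * g t - p (exp (- t)) * g t\<bar>)"
        using fint pint by (intro integrable_abs Bochner_Integration.integrable_diff)
      show "integrable lborel (\<lambda>t. e * \<bar>g t\<bar>)" using g by (intro integrable_mult_right integrable_abs)
      fix t :: real
      show "\<bar>f (exp (- t)) * g t - p (exp (- t)) * g t\<bar> \<le> e * \<bar>g t\<bar>"
      proof (cases "t > 0")
        case True
        then have "\<bar>f (exp (- t)) - p (exp (- t))\<bar> \<le> e" by (intro less_imp_le p(2)) auto
        then show ?thesis
          unfolding left_diff_distrib[symmetric] abs_mult by (rule mult_right_mono) simp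
      qed (use g(2)[of t] in simp)
    qed
    finally show ?thesis by simp
  qed
  note bound = this
  define G where "G = (\<integral>t. \<bar>g t\<bar> \<partial>lborel)"
  have G: "G \<ge> 0" by (simp add: G_def)
  have "\<bar>\<integral>t. f (exp (- t)) * g t \<partial>lborel\<bar> \<le> 0"
  proof (rule field_le_epsilon)
    fix e :: real assume "e > 0"
    then have "\<bar>\<integral>t. f (exp (- t)) * g t \<partial>lborel\<bar> \<le> e / (G + 1) * G"
      using bound[of "e / (G + 1)"] G unfolding G_def[symmetric] by simp
    also have "\<dots> \<le> e" using G \<open>e > 0\<close> by (simp add: field_simps)
    finally show "\<bar>\<integral>t. f (exp (- t)) * g t \<partial>lborel\<bar> \<le> 0 + e" by simp
  qed
  then show ?thesis by simp
qed

text \<open>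
  The indicator of an open interval is a bounded pointwise limit of continuous functions.
\<close>

lemma laplace_vanishing_interval:
  fixes g :: "real \<Rightarrow> real"
  assumes g: "integrable lborel g" "\<And>t. t \<le> 0 \<Longrightarrow> g t = 0"
    and mom: "\<And>n::nat. integrable lborel (\<lambda>t. exp (- t) ^ n * g t)" "\<And>n::nat. (\<integral>t. exp (- t) ^ n * g t \<partial>lborel) = 0"
  shows "(\<integral>t. indicator {a<..<b} t * g t \<partial>lborel) = 0"
proof -
  \<comment> \<open>Trapezoidal functions, which increase to the indicator of the interval from exp (- b) to exp (- a).\<close>
  define f where "f n x = min 1 (real n * max 0 (min (x - exp (- b)) (exp (- a) - x)))" for n x
  note [measurable] = borel_measurable_integrable[OF g(1)]
  have c: "continuous_on UNIV (f n)" for n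
    unfolding f_def by (intro continuous_intros)
  then have [measurable]: "f n \<in> borel_measurable borel" for n
    by (rule borel_measurable_continuous_onI)
  have bd: "\<bar>f n x\<bar> \<le> 1" for n x by (auto simp: f_def)
  have lim: "(\<lambda>n. f n (exp (- t))) \<longlonglongrightarrow> indicator {a<..<b} t" for t
  proof (cases "t \<in> {a<..<b}")
    case True
    define d where "d = min (exp (- t) - exp (- b)) (exp (- a) - exp (- t))"
    have d: "d > 0" using True by (auto simp: d_def)
    obtain n0 :: nat where n0: "1 / d < real n0" using reals_Archimedean2 by blast
    have "f n (exp (- t)) = 1" if "n \<ge> n0" for n
    proof -
      have "1 / d < real n" using n0 that by linarith
      then have "1 \<le> real n * d" using d by (simp add: field_simps)
      then show ?thesis using d unfolding f_def d_def[symmetric] by simp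
    qed
    then have "eventually (\<lambda>n. f n (exp (- t)) = 1) sequentially"
      unfolding eventually_sequentially by blast
    then show ?thesis using True by (simp add: tendsto_eventually)
  next
    case False
    then have "min (exp (- t) - exp (- b)) (exp (- a) - exp (- t)) \<le> 0"
      by (auto simp: min_le_iff_disj)
    then have "f n (exp (- t)) = 0" for n
      unfolding f_def by (simp only: max_absorb1 mult_zero_right)
    then show ?thesis using False by simp
  qed
  have "(\<lambda>n. \<integral>t. f n (exp (- t)) * g t \<partial>lborel) \<longlonglongrightarrow> (\<integral>t. indicator {a<..<b} t * g t \<partial>lborel)"
  proof (rule integral_dominated_convergence)
    show "integrable lborel (\<lambda>t. \<bar>g t\<bar>)" using g by simp
    show "AE t in lborel. (\<lambda>n. f n (exp (- t)) * g t) \<longlonglongrightarrow> indicator {a<..<b} t * g t"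
      by (intro AE_I2 tendsto_mult lim tendsto_const)
    show "AE t in lborel. norm (f n (exp (- t)) * g t) \<le> \<bar>g t\<bar>" for n
      by (auto simp: abs_mult intro!: mult_left_le_one_le bd)
  qed measurable
  then have "(\<lambda>n. 0) \<longlonglongrightarrow> (\<integral>t. indicator {a<..<b} t * g t \<partial>lborel)"
    using laplace_vanishing_continuous[OF g mom c bd] by simp
  then show ?thesis by (simp add: LIMSEQ_const_iff)
qed

text \<open>
  Lerch's theorem. The transforms at \<open>\<mu>0, \<mu>0 + 1, \<mu>0 + 2, \<dots>\<close> are the moments of
  \<open>exp (- \<mu>0 * t) * h t\<close> in the variable \<open>exp (- t)\<close>, so the integral of this function over every
  interval is zero. A nonzero value at \<open>t\<close> would persist with its sign on a short interval to the left
  of \<open>t\<close>. One-sided continuity is the right generality, because distribution functions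
  \<open>t \<mapsto> P(X < t)\<close> are continuous from the left only.
\<close>

lemma laplace_vanishing_left_continuous:
  fixes h :: "real \<Rightarrow> real"
  assumes int: "\<And>\<mu>. \<mu> \<ge> \<mu>0 \<Longrightarrow> integrable lborel (\<lambda>t. indicator {0<..} t * (exp (- \<mu> * t) * h t))"
    and zero: "\<And>\<mu>. \<mu> \<ge> \<mu>0 \<Longrightarrow> (\<integral>t. indicator {0<..} t * (exp (- \<mu> * t) * h t) \<partial>lborel) = 0"
    and "t > 0" and lc: "(h \<longlongrightarrow> h t) (at_left t)"
  shows "h t = 0"
proof (rule ccontr)
  assume nz: "h t \<noteq> 0"
  define g where "g s = indicator {0<..} s * (exp (- \<mu>0 * s) * h s)" for s
  have shift: "exp (- s) ^ n * g s = indicator {0<..} s * (exp (- (\<mu>0 + real n) * s) * h s)" for s n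
    by (simp add: g_def exp_of_nat_mult[symmetric] mult_exp_exp algebra_simps)
  have g: "integrable lborel g" unfolding g_def by (rule int) simp
  have van: "(\<integral>s. indicator {a<..<b} s * g s \<partial>lborel) = 0" for a b
  proof (rule laplace_vanishing_interval[OF g])
    show "g s = 0" if "s \<le> 0" for s using that by (simp add: g_def)
    show "integrable lborel (\<lambda>t. exp (- t) ^ n * g t)" for n unfolding shift by (rule int) simp
    show "(\<integral>t. exp (- t) ^ n * g t \<partial>lborel) = 0" for n unfolding shift by (rule zero) simp
  qed
  \<comment> \<open>Multiplying by the value c at t itself makes both signs one case: c * g s tends to c * c > 0.\<close>
  define c where "c = exp (- \<mu>0 * t) * h t"
  have c: "c\<^sup>2 > 0" using nz by (simp add: c_def)
  have "((\<lambda>s. c * (exp (- \<mu>0 * s) * h s)) \<longlongrightarrow> c * c) (at_left t)"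
    unfolding c_def[of] by (intro tendsto_intros lc)
  then have "eventually (\<lambda>s. c * (exp (- \<mu>0 * s) * h s) > c\<^sup>2 / 2) (at_left t)"
    using c by (intro order_tendstoD) (auto simp: power2_eq_square)
  then obtain a where a: "a < t" "\<And>s. a < s \<Longrightarrow> s < t \<Longrightarrow> c * (exp (- \<mu>0 * s) * h s) > c\<^sup>2 / 2"
    unfolding eventually_at_left_field by blast
  define a' where "a' = max 0 a"
  have a': "a' < t" using a assms by (simp add: a'_def)
  have "(\<integral>s. indicator {a'<..<t} s * (c\<^sup>2 / 2) \<partial>lborel) \<le> (\<integral>s. c * (indicator {a'<..<t} s * g s) \<partial>lborel)"
  proof (rule integral_mono)
    show "integrable lborel (\<lambda>s. indicator {a'<..<t} s * (c\<^sup>2 / 2))"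
      by (intro integrable_mult_left integrable_real_indicator) (auto simp: emeasure_lborel_Ioo a' less_imp_le)
    show "integrable lborel (\<lambda>s. c * (indicator {a'<..<t} s * g s))"
      by (intro integrable_mult_right) (use g in \<open>auto intro!: integrable_real_mult_indicator simp: mult.commute\<close>)
    show "indicator {a'<..<t} s * (c\<^sup>2 / 2) \<le> c * (indicator {a'<..<t} s * g s)" for s
      using a(2)[of s] by (auto simp: indicator_def a'_def g_def)
  qed
  moreover have "(\<integral>s. indicator {a'<..<t} s * (c\<^sup>2 / 2) \<partial>lborel) = (t - a') * (c\<^sup>2 / 2)"
    using a' by simp
  moreover have "(t - a') * (c\<^sup>2 / 2) > 0" using a' c by simp
  moreover have "(\<integral>s. c * (indicator {a'<..<t} s * g s) \<partial>lborel) = 0"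
    using van[of a' t] by simp
  ultimately show False by linarith
qed

section \<open>A Poisson process at an independent random time\<close>

definition poisson_weight :: "real \<Rightarrow> nat \<Rightarrow> real \<Rightarrow> real" where
  "poisson_weight r k s = (r * s) ^ k / fact k * exp (- (r * s))"

lemma continuous_poisson_weight: "continuous_on UNIV (poisson_weight r k)"
  unfolding poisson_weight_def by (intro continuous_intros) auto

lemma measurable_poisson_weight [measurable]: "poisson_weight r k \<in> borel_measurable borel"
  by (intro borel_measurable_continuous_onI continuous_poisson_weight)

lemma poisson_weight_has_derivative:
  "(poisson_weight r k has_real_derivative
      r * ((if k = 0 then 0 else poisson_weight r (k - 1) s) - poisson_weight r k s)) (at s)"
proof (cases k)
  case 0
  then show ?thesis unfolding poisson_weight_def
    by (auto intro!: derivative_eq_intros)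
next
  case (Suc j)
  have "((\<lambda>s. (r * s) ^ Suc j / fact (Suc j) * exp (- (r * s))) has_real_derivative
     (real (Suc j) * (r * s) ^ j * r / fact (Suc j) * exp (- (r * s)) + (r * s) ^ Suc j / fact (Suc j) * (exp (- (r * s)) * - r))) (at s)"
    by (rule derivative_eq_intros refl | simp add: mult_ac)+
  also have "real (Suc j) * (r * s) ^ j * r / fact (Suc j) = r * ((r * s) ^ j / fact j)"
    by (simp add: fact_Suc del: of_nat_Suc)
  finally show ?thesis unfolding Suc poisson_weight_def
    by (simp add: algebra_simps del: fact_Suc)
qed

text \<open>
  Up to the factor \<open>r\<close>, the case \<open>c = 0\<close> is the total mass of an Erlang density.
\<close>

lemma poisson_weight_laplace:
  assumes "r > 0" "c \<ge> 0"
  shows "has_bochner_integral lborel (\<lambda>s. indicator {0<..} s * (poisson_weight r k s * exp (- s * c)))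
           (r ^ k / (r + c) ^ Suc k)"
proof -
  have "has_bochner_integral lborel
      (\<lambda>t. r ^ k / fact k * (indicator {0<..} t * (t powr ((real k + 1) - 1) * exp (- (r + c) * t))))
      (r ^ k / fact k * (Gamma (real k + 1) / (r + c) powr (real k + 1)))"
    using assms by (intro has_bochner_integral_mult_right Gamma_integral_exp) auto
  also have "(\<lambda>t. r ^ k / fact k * (indicator {0<..} t * (t powr ((real k + 1) - 1) * exp (- (r + c) * t))))
      = (\<lambda>s. indicator {0<..} s * (poisson_weight r k s * exp (- s * c)))"
    by (auto simp: fun_eq_iff indicator_def poisson_weight_def powr_realpow power_mult_distrib mult_exp_exp algebra_simps)
  also have "r ^ k / fact k * (Gamma (real k + 1) / (r + c) powr (real k + 1)) = r ^ k / (r + c) ^ Suc k"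
  proof -
    have "Gamma (real k + 1) = fact k" using Gamma_fact[of k, where 'a = real] by (simp add: add.commute)
    moreover have "(r + c) powr (real k + 1) = (r + c) ^ Suc k"
      using assms powr_realpow[of "r + c" "Suc k"] by (simp add: add.commute)
    ultimately show ?thesis by simp
  qed
  finally show ?thesis .
qed

context prob_space
begin

text \<open>
  Condition on the value of \<open>J\<close>: on each event \<open>J = j\<close> the time is the constant \<open>d j\<close>, and
  independence factorises the probability.
\<close>

lemma poisson_at_countably_valued_time:
  fixes N :: "real \<Rightarrow> 'a \<Rightarrow> nat" and J :: "'a \<Rightarrow> nat" and d :: "nat \<Rightarrow> real"
  assumes N: "poisson_process r N"
    and d: "\<And>j. d j \<ge> 0"
    and J [measurable]: "J \<in> M \<rightarrow>\<^sub>M count_space UNIV"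
    and indep: "\<And>j. indep_var borel (\<lambda>\<omega>. real (N (d j) \<omega>)) borel (\<lambda>\<omega>. real (J \<omega>))"
  shows "{\<omega> \<in> space M. N (d (J \<omega>)) \<omega> = k} \<in> events"
    and "prob {\<omega> \<in> space M. N (d (J \<omega>)) \<omega> = k} = expectation (\<lambda>\<omega>. poisson_weight r k (d (J \<omega>)))"
proof -
  have Nm [measurable]: "random_variable borel (\<lambda>\<omega>. real (N (d j) \<omega>))" for j
    using indep_var_rv1[OF indep[of j]] .
  define A where "A j = {\<omega> \<in> space M. real (N (d j) \<omega>) \<in> {real k} \<and> real (J \<omega>) \<in> {real j}}" for j
  have A [measurable]: "A j \<in> events" for j unfolding A_def by measurable
  have un: "{\<omega> \<in> space M. N (d (J \<omega>)) \<omega> = k} = (\<Union>j. A j)" by (auto simp: A_def)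
  show "{\<omega> \<in> space M. N (d (J \<omega>)) \<omega> = k} \<in> events" unfolding un by measurable
  have weight: "prob {\<omega> \<in> space M. real (N (d j) \<omega>) \<in> {real k}} = poisson_weight r k (d j)" for j
    using N d[of j] by (simp add: poisson_process_def poisson_weight_def)
  then have nonneg: "poisson_weight r k (d j) \<ge> 0" for j by (metis measure_nonneg)
  have PA: "emeasure M (A j) = ennreal (poisson_weight r k (d j)) * emeasure M {\<omega> \<in> space M. J \<omega> = j}" for j
  proof -
    have "prob (A j) = poisson_weight r k (d j) * prob {\<omega> \<in> space M. real (J \<omega>) \<in> {real j}}"
      unfolding A_def weight[symmetric]
      by (rule prob_indep_random_variable[OF indep]) auto
    also have "{\<omega> \<in> space M. real (J \<omega>) \<in> {real j}} = {\<omega> \<in> space M. J \<omega> = j}" by auto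
    finally show ?thesis by (simp add: emeasure_eq_measure ennreal_mult nonneg)
  qed
  have disj: "disjoint_family A" by (auto simp: disjoint_family_on_def A_def)
  have "emeasure M {\<omega> \<in> space M. N (d (J \<omega>)) \<omega> = k} = (\<Sum>j. emeasure M (A j))"
    unfolding un using disj by (intro suminf_emeasure[symmetric]) auto
  also have "\<dots> = (\<Sum>j. \<integral>\<^sup>+\<omega>. ennreal (poisson_weight r k (d j)) * indicator {\<omega> \<in> space M. J \<omega> = j} \<omega> \<partial>M)"
    unfolding PA by (subst nn_integral_cmult_indicator) auto
  also have "\<dots> = (\<integral>\<^sup>+\<omega>. (\<Sum>j. ennreal (poisson_weight r k (d j)) * indicator {\<omega> \<in> space M. J \<omega> = j} \<omega>) \<partial>M)"
    by (rule nn_integral_suminf[symmetric]) measurable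
  also have "\<dots> = (\<integral>\<^sup>+\<omega>. ennreal (poisson_weight r k (d (J \<omega>))) \<partial>M)"
  proof (rule nn_integral_cong)
    fix \<omega> assume "\<omega> \<in> space M"
    then show "(\<Sum>j. ennreal (poisson_weight r k (d j)) * indicator {\<omega> \<in> space M. J \<omega> = j} \<omega>)
        = ennreal (poisson_weight r k (d (J \<omega>)))"
      by (subst suminf_finite[of "{J \<omega>}"]) auto
  qed
  finally have e: "(\<integral>\<^sup>+\<omega>. ennreal (poisson_weight r k (d (J \<omega>))) \<partial>M)
      = ennreal (prob {\<omega> \<in> space M. N (d (J \<omega>)) \<omega> = k})"
    by (simp add: emeasure_eq_measure)
  show "prob {\<omega> \<in> space M. N (d (J \<omega>)) \<omega> = k} = expectation (\<lambda>\<omega>. poisson_weight r k (d (J \<omega>)))"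
    by (rule sym, rule integral_eq_nn_integral[THEN trans]) (use nonneg in \<open>auto simp: e\<close>)
qed

text \<open>
  Round \<open>T\<close> up to the grid of mesh \<open>1 / (n + 1)\<close> and let \<open>n\<close> tend to infinity. Rounding upwards makes
  right-continuity of the paths applicable, and an integer-valued right-continuous path is constant
  immediately after \<open>T\<close>. This avoids joint measurability of \<open>N\<close> in time and outcome.
\<close>

lemma poisson_at_independent_time:
  fixes N :: "real \<Rightarrow> 'a \<Rightarrow> nat" and T :: "'a \<Rightarrow> real"
  assumes N: "poisson_process r N" and r: "r \<ge> 0"
    and T: "\<And>\<omega>. \<omega> \<in> space M \<Longrightarrow> T \<omega> \<ge> 0"
    and indep: "\<And>s. s \<ge> 0 \<Longrightarrow> indep_var borel (\<lambda>\<omega>. real (N s \<omega>)) borel T"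
  shows "prob {\<omega> \<in> space M. N (T \<omega>) \<omega> = k} = expectation (\<lambda>\<omega>. poisson_weight r k (T \<omega>))"
proof -
  have [measurable]: "random_variable borel T" using indep_var_rv2[OF indep[of 0]] by simp
  define J where "J n x = nat \<lceil>x * (real n + 1)\<rceil>" for n :: nat and x :: real
  define D where "D n j = real j / (real n + 1)" for n j :: nat
  have [measurable]: "J n \<in> borel \<rightarrow>\<^sub>M count_space UNIV" for n unfolding J_def by measurable
  define E where "E n = {\<omega> \<in> space M. N (D n (J n (T \<omega>))) \<omega> = k}" for n
  have ind: "indep_var borel (\<lambda>\<omega>. real (N (D n j) \<omega>)) borel (\<lambda>\<omega>. real (J n (T \<omega>)))" for n j
    using indep_var_compose[OF indep[of "D n j"], of "\<lambda>x. x" borel "\<lambda>x. real (J n x)" borel]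
    by (simp add: comp_def D_def)
  have E: "E n \<in> events" "prob (E n) = expectation (\<lambda>\<omega>. poisson_weight r k (D n (J n (T \<omega>))))" for n
    unfolding E_def using poisson_at_countably_valued_time[OF N _ _ ind] by (auto simp: D_def)
  have DJ: "T \<omega> \<le> D n (J n (T \<omega>))" "D n (J n (T \<omega>)) \<le> T \<omega> + 1 / (real n + 1)" if "\<omega> \<in> space M" for \<omega> n
  proof -
    have "T \<omega> * (real n + 1) \<le> real (J n (T \<omega>))" "real (J n (T \<omega>)) \<le> T \<omega> * (real n + 1) + 1"
      using T[OF that] unfolding J_def by (auto simp: of_nat_nat)
    from this[THEN divide_right_mono, of "real n + 1"]
    show "T \<omega> \<le> D n (J n (T \<omega>))" "D n (J n (T \<omega>)) \<le> T \<omega> + 1 / (real n + 1)"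
      by (simp_all add: D_def add_divide_distrib)
  qed
  have lim: "(\<lambda>n. D n (J n (T \<omega>))) \<longlonglongrightarrow> T \<omega>" if "\<omega> \<in> space M" for \<omega>
  proof (rule tendsto_sandwich[OF _ _ tendsto_const])
    show "(\<lambda>n. T \<omega> + 1 / (real n + 1)) \<longlonglongrightarrow> T \<omega>"
      using tendsto_add[OF tendsto_const[of "T \<omega>"] LIMSEQ_inverse_real_of_nat]
      by (simp add: inverse_eq_divide add.commute)
    show "\<forall>\<^sub>F n in sequentially. T \<omega> \<le> D n (J n (T \<omega>))"
      "\<forall>\<^sub>F n in sequentially. D n (J n (T \<omega>)) \<le> T \<omega> + 1 / (real n + 1)"
      using DJ[OF that] by auto
  qed
  have ev: "eventually (\<lambda>n. N (D n (J n (T \<omega>))) \<omega> = N (T \<omega>) \<omega>) sequentially" if \<omega>: "\<omega> \<in> space M" for \<omega>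
  proof -
    have "((\<lambda>s. real (N s \<omega>)) \<longlongrightarrow> real (N (T \<omega>) \<omega>)) (at_right (T \<omega>))"
      using N \<omega> T[OF \<omega>] unfolding poisson_process_def levy_process_def by blast
    then have "eventually (\<lambda>s. dist (real (N s \<omega>)) (real (N (T \<omega>) \<omega>)) < 1) (at_right (T \<omega>))"
      by (rule tendstoD) simp
    then obtain b where b: "b > T \<omega>" "\<And>s. T \<omega> < s \<Longrightarrow> s < b \<Longrightarrow> dist (real (N s \<omega>)) (real (N (T \<omega>) \<omega>)) < 1"
      unfolding eventually_at_right_field by blast
    have eq: "N s \<omega> = N (T \<omega>) \<omega>" if "T \<omega> \<le> s" "s < b" for s
      using b(2)[of s] that by (cases "s = T \<omega>") (auto simp: dist_real_def abs_less_iff)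
    have "eventually (\<lambda>n. D n (J n (T \<omega>)) < b) sequentially"
      using lim[OF \<omega>] b(1) by (rule order_tendstoD)
    then show ?thesis by (rule eventually_mono) (use eq DJ[OF \<omega>] in auto)
  qed
  define E' where "E' = {\<omega> \<in> space M. N (T \<omega>) \<omega> = k}"
  have evE: "eventually (\<lambda>n. \<omega> \<in> E n \<longleftrightarrow> \<omega> \<in> E') sequentially" if "\<omega> \<in> space M" for \<omega>
    using ev[OF that] by (rule eventually_mono) (use that in \<open>auto simp: E_def E'_def\<close>)
  have "E' = (\<Union>m. \<Inter>n\<in>{m..}. E n)"
  proof (intro set_eqI iffI)
    fix \<omega> assume "\<omega> \<in> E'"
    then show "\<omega> \<in> (\<Union>m. \<Inter>n\<in>{m..}. E n)"
      using evE[of \<omega>] by (auto simp: eventually_sequentially E'_def)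
  next
    fix \<omega> assume *: "\<omega> \<in> (\<Union>m. \<Inter>n\<in>{m..}. E n)"
    then have "\<omega> \<in> space M" by (auto simp: E_def)
    from evE[OF this] obtain m' where m': "\<And>n. n \<ge> m' \<Longrightarrow> \<omega> \<in> E n \<longleftrightarrow> \<omega> \<in> E'"
      unfolding eventually_sequentially by blast
    from * obtain m where "\<And>n. n \<ge> m \<Longrightarrow> \<omega> \<in> E n" by auto
    then show "\<omega> \<in> E'" using m'[of "max m m'"] by simp
  qed
  then have E'[measurable]: "E' \<in> events" using E(1) by auto
  note [measurable] = E(1)
  have "(\<lambda>n. expectation (indicator (E n) :: 'a \<Rightarrow> real)) \<longlonglongrightarrow> expectation (indicator E')"
  proof (rule integral_dominated_convergence[where w = "\<lambda>_. 1"])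
    show "AE \<omega> in M. (\<lambda>n. indicator (E n) \<omega>) \<longlonglongrightarrow> (indicator E' \<omega> :: real)"
      by (intro AE_I2 tendsto_eventually eventually_mono[OF evE]) (auto simp: indicator_def)
  qed (auto simp: indicator_def)
  then have "(\<lambda>n. prob (E n)) \<longlonglongrightarrow> prob E'" by simp
  moreover have "(\<lambda>n. prob (E n)) \<longlonglongrightarrow> expectation (\<lambda>\<omega>. poisson_weight r k (T \<omega>))"
    unfolding E(2)
  proof (rule integral_dominated_convergence[where w = "\<lambda>_. 1"])
    show "AE \<omega> in M. (\<lambda>n. poisson_weight r k (D n (J n (T \<omega>)))) \<longlonglongrightarrow> poisson_weight r k (T \<omega>)"
      by (intro AE_I2 isCont_tendsto_compose[OF _ lim])
         (use continuous_poisson_weight in \<open>auto simp: continuous_on_eq_continuous_at\<close>)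
    show "AE \<omega> in M. norm (poisson_weight r k (D n (J n (T \<omega>)))) \<le> 1" for n
    proof (rule AE_I2)
      fix \<omega>
      have "0 \<le> D n (J n (T \<omega>))" by (simp add: D_def)
      then have "poisson_weight r k (D n (J n (T \<omega>))) = prob {\<omega>' \<in> space M. N (D n (J n (T \<omega>))) \<omega>' = k}"
        using N by (simp add: poisson_process_def poisson_weight_def)
      then show "norm (poisson_weight r k (D n (J n (T \<omega>)))) \<le> 1" by simp
    qed
    show "(\<lambda>\<omega>. poisson_weight r k (D n (J n (T \<omega>)))) \<in> borel_measurable M" for n
    proof -
      have "(\<lambda>j. poisson_weight r k (D n j)) \<in> count_space UNIV \<rightarrow>\<^sub>M borel" by simp
      then show ?thesis by measurable
    qed
  qed auto
  ultimately show ?thesis unfolding E'_def by (rule LIMSEQ_unique)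
qed

end

section \<open>First passage of a subordinator\<close>

text \<open>
  By monotonicity and left-continuity in the second variable, \<open>c < f s t\<close> holds iff \<open>c < f s r\<close> for
  some rational \<open>r < t\<close>, so the superlevel sets are countable unions of rectangles.
\<close>

lemma borel_measurable_mono_left_continuous:
  fixes f :: "real \<Rightarrow> real \<Rightarrow> real"
  assumes meas: "\<And>t. (\<lambda>s. f s t) \<in> borel_measurable borel"
    and mono: "\<And>s t u. t \<le> u \<Longrightarrow> f s t \<le> f s u"
    and lc: "\<And>s t. (f s \<longlongrightarrow> f s t) (at_left t)"
  shows "(\<lambda>x. f (fst x) (snd x)) \<in> borel_measurable (borel \<Otimes>\<^sub>M borel)"
  unfolding borel_measurable_iff_greater
proof
  fix c :: real
  have "{x \<in> space (borel \<Otimes>\<^sub>M borel). c < f (fst x) (snd x)} = (\<Union>r\<in>\<rat>. {s. c < f s r} \<times> {r<..})"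
  proof (intro set_eqI iffI)
    fix x assume "x \<in> {x \<in> space (borel \<Otimes>\<^sub>M borel). c < f (fst x) (snd x)}"
    then have "c < f (fst x) (snd x)" by simp
    then have "eventually (\<lambda>t. c < f (fst x) t) (at_left (snd x))"
      using lc by (intro order_tendstoD)
    then obtain a where a: "a < snd x" "\<And>t. a < t \<Longrightarrow> t < snd x \<Longrightarrow> c < f (fst x) t"
      unfolding eventually_at_left_field by blast
    obtain r where "r \<in> \<rat>" "a < r" "r < snd x" using Rats_dense_in_real[OF a(1)] by blast
    then show "x \<in> (\<Union>r\<in>\<rat>. {s. c < f s r} \<times> {r<..})"
      using a(2)[of r] by (cases x) auto
  next
    fix x assume "x \<in> (\<Union>r\<in>\<rat>. {s. c < f s r} \<times> {r<..})"
    then show "x \<in> {x \<in> space (borel \<Otimes>\<^sub>M borel). c < f (fst x) (snd x)}"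
      using mono by (force simp: space_pair_measure intro: less_le_trans)
  qed
  also have "\<dots> \<in> sets (borel \<Otimes>\<^sub>M borel)"
  proof (intro sets.countable_UN'' countable_rat pair_measureI)
    show "{s. c < f s r} \<in> sets borel" for r
      using meas[of r] by measurable
  qed auto
  finally show "{x \<in> space (borel \<Otimes>\<^sub>M borel). c < f (fst x) (snd x)} \<in> sets (borel \<Otimes>\<^sub>M borel)" .
qed

text \<open>
  Fubini's theorem in the only form used here: for the product of an integrable function with a random
  set. It serves the tail formula for expectations and the Laplace transform of a distribution
  function.
\<close>

lemma (in prob_space) integral_times_prob_swap:
  fixes g :: "real \<Rightarrow> real" and A :: "real \<Rightarrow> 'a \<Rightarrow> bool"
  assumes g: "integrable lborel g"
    and A: "Measurable.pred (lborel \<Otimes>\<^sub>M M) (\<lambda>x. A (fst x) (snd x))"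
  shows "integrable M (\<lambda>\<omega>. \<integral>s. g s * of_bool (A s \<omega>) \<partial>lborel)"
    and "(\<integral>\<omega>. (\<integral>s. g s * of_bool (A s \<omega>) \<partial>lborel) \<partial>M)
      = (\<integral>s. g s * prob {\<omega> \<in> space M. A s \<omega>} \<partial>lborel)"
proof -
  interpret P: pair_sigma_finite lborel M ..
  note [measurable] = borel_measurable_integrable[OF g] A
  have [measurable]: "Measurable.pred M (A s)" for s
    using measurable_compose[OF measurable_Pair1'[of s lborel M] A] by simp
  define f where "f s \<omega> = g s * of_bool (A s \<omega>)" for s \<omega>
  have f_if: "f s \<omega> = (if A s \<omega> then g s else 0)" for s \<omega> by (simp add: f_def)
  have [measurable]: "case_prod f \<in> borel_measurable (lborel \<Otimes>\<^sub>M M)"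
    unfolding f_if case_prod_unfold by measurable
  have inner: "(\<integral>\<omega>. f s \<omega> \<partial>M) = g s * prob {\<omega> \<in> space M. A s \<omega>}" for s
  proof -
    have "(\<integral>\<omega>. f s \<omega> \<partial>M) = (\<integral>\<omega>. g s * indicator {\<omega> \<in> space M. A s \<omega>} \<omega> \<partial>M)"
      by (intro Bochner_Integration.integral_cong) (auto simp: f_def)
    then show ?thesis by simp
  qed
  have int: "integrable (lborel \<Otimes>\<^sub>M M) (case_prod f)"
  proof (rule P.Fubini_integrable)
    show "integrable lborel (\<lambda>x. \<integral>y. norm (case (x, y) of (x, xa) \<Rightarrow> f x xa) \<partial>M)"
    proof (rule Bochner_Integration.integrable_bound[OF g])
      show "AE x in lborel. norm (\<integral>y. norm (case (x, y) of (x, xa) \<Rightarrow> f x xa) \<partial>M) \<le> norm (g x)"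
      proof (rule AE_I2)
        fix x :: real
        have "(\<integral>y. \<bar>f x y\<bar> \<partial>M) \<le> (\<integral>y. \<bar>g x\<bar> \<partial>M)"
          by (rule integral_mono_AE') (auto simp: f_def abs_mult)
        then show "norm (\<integral>y. norm (case (x, y) of (x, xa) \<Rightarrow> f x xa) \<partial>M) \<le> norm (g x)"
          by (simp add: prob_space)
      qed
    qed measurable
    show "AE x in lborel. integrable M (\<lambda>y. case (x, y) of (x, xa) \<Rightarrow> f x xa)"
    proof (rule AE_I2)
      fix x :: real
      have "(\<lambda>\<omega>. f x \<omega>) \<in> borel_measurable M" unfolding f_if by measurable
      then show "integrable M (\<lambda>y. case (x, y) of (x, xa) \<Rightarrow> f x xa)"
        by (intro integrable_const_bound[where B = "\<bar>g x\<bar>"]) (auto simp: f_def)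
    qed
  qed measurable
  show "integrable M (\<lambda>\<omega>. \<integral>s. g s * of_bool (A s \<omega>) \<partial>lborel)"
    using P.integrable_snd[OF int] unfolding f_def .
  show "(\<integral>\<omega>. (\<integral>s. g s * of_bool (A s \<omega>) \<partial>lborel) \<partial>M)
      = (\<integral>s. g s * prob {\<omega> \<in> space M. A s \<omega>} \<partial>lborel)"
    using P.Fubini_integral[OF int, unfolded inner] unfolding f_def .
qed

text \<open>
  Write \<open>g (X \<omega>) - g 0\<close> as the integral of \<open>g'\<close> over \<open>[0, X \<omega>]\<close> and exchange the integrals.
\<close>

lemma (in prob_space) expectation_eq_integral_tail:
  fixes X :: "'a \<Rightarrow> real" and g g' :: "real \<Rightarrow> real"
  assumes X [measurable]: "random_variable borel X" and X0: "\<And>\<omega>. \<omega> \<in> space M \<Longrightarrow> X \<omega> \<ge> 0"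
    and g: "\<And>x. (g has_real_derivative g' x) (at x)" and g': "continuous_on UNIV g'"
    and int: "integrable lborel (\<lambda>s. indicator {0<..} s * g' s)"
  shows "expectation (\<lambda>\<omega>. g (X \<omega>)) =
    g 0 + (\<integral>s. indicator {0<..} s * g' s * prob {\<omega> \<in> space M. s < X \<omega>} \<partial>lborel)"
proof -
  have [measurable]: "g' \<in> borel_measurable borel" using g' by (rule borel_measurable_continuous_onI)
  have "Measurable.pred (lborel \<Otimes>\<^sub>M M) (\<lambda>x. fst x < X (snd x))" by measurable
  note swap = integral_times_prob_swap[OF int this]
  have outer: "(\<integral>s. indicator {0<..} s * g' s * of_bool (s < X \<omega>) \<partial>lborel) = g (X \<omega>) - g 0"
    if "\<omega> \<in> space M" for \<omega>
  proof -
    have "(\<integral>s. indicator {0<..} s * g' s * of_bool (s < X \<omega>) \<partial>lborel)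
        = (\<integral>s. g' s * indicator {0..X \<omega>} s \<partial>lborel)"
    proof (rule integral_cong_AE)
      show "AE s in lborel. indicator {0<..} s * g' s * of_bool (s < X \<omega>) = g' s * indicator {0..X \<omega>} s"
        using AE_lborel_singleton[of 0] AE_lborel_singleton[of "X \<omega>"]
        by eventually_elim (auto simp: indicator_def)
    qed measurable
    also have "\<dots> = g (X \<omega>) - g 0"
      using g g' X0[OF that] by (intro integral_FTC_Icc_real) (auto simp: continuous_on_eq_continuous_at)
    finally show ?thesis .
  qed
  have "integrable M (\<lambda>\<omega>. g (X \<omega>) - g 0)"
    using swap(1) by (rule Bochner_Integration.integrable_cong[OF refl outer, THEN iffD1, rotated])
  then have "expectation (\<lambda>\<omega>. g 0 + (g (X \<omega>) - g 0)) = g 0 + expectation (\<lambda>\<omega>. g (X \<omega>) - g 0)"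
    by (subst Bochner_Integration.integral_add) (auto simp: prob_space)
  also have "expectation (\<lambda>\<omega>. g (X \<omega>) - g 0)
      = expectation (\<lambda>\<omega>. \<integral>s. indicator {0<..} s * g' s * of_bool (s < X \<omega>) \<partial>lborel)"
    by (intro Bochner_Integration.integral_cong) (auto simp: outer)
  finally show ?thesis using swap(2) by simp
qed

text \<open>
  The properties of \<open>H1 + (2 l) powr (1 / \<nu>) * H2\<close> on which the law of its first passage time
  depends: the event \<open>s < first_passage t\<close> involves \<open>S\<close> at the single time \<open>s\<close>, so this law is encoded
  in the Laplace transforms of the variables \<open>S s\<close>.
\<close>

locale laplace_subordinator = prob_space M for M :: "'a measure" +
  fixes S :: "real \<Rightarrow> 'a \<Rightarrow> real" and \<phi> :: "real \<Rightarrow> real"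
  assumes S_measurable: "\<And>s. s \<ge> 0 \<Longrightarrow> random_variable borel (S s)"
    and S_0: "\<And>\<omega>. \<omega> \<in> space M \<Longrightarrow> S 0 \<omega> = 0"
    and S_mono: "\<And>\<omega> s t. \<omega> \<in> space M \<Longrightarrow> 0 \<le> s \<Longrightarrow> s \<le> t \<Longrightarrow> S s \<omega> \<le> S t \<omega>"
    and S_right: "\<And>\<omega> s. \<omega> \<in> space M \<Longrightarrow> 0 \<le> s \<Longrightarrow> ((\<lambda>u. S u \<omega>) \<longlongrightarrow> S s \<omega>) (at_right s)"
    and S_laplace: "\<And>s \<mu>. s \<ge> 0 \<Longrightarrow> \<mu> > 0 \<Longrightarrow> expectation (\<lambda>\<omega>. exp (- \<mu> * S s \<omega>)) = exp (- s * \<phi> \<mu>)"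
    and \<phi>_pos: "\<And>\<mu>. \<mu> > 0 \<Longrightarrow> \<phi> \<mu> > 0"
begin

text \<open>
  The truncation \<open>max 0 s\<close> makes this a monotone function of \<open>s\<close> on the whole line, although \<open>S\<close> is
  unconstrained at negative times.
\<close>

definition below_prob :: "real \<Rightarrow> real \<Rightarrow> real" where
  "below_prob s t = prob {\<omega> \<in> space M. S (max 0 s) \<omega> < t}"

lemma S_max_measurable [measurable]: "random_variable borel (S (max 0 s))"
  by (rule S_measurable) simp

lemma S_nonneg: "\<omega> \<in> space M \<Longrightarrow> 0 \<le> s \<Longrightarrow> 0 \<le> S s \<omega>"
  using S_mono[of \<omega> 0 s] S_0[of \<omega>] by simp

lemma below_prob_bounds: "0 \<le> below_prob s t" "below_prob s t \<le> 1"
  by (simp_all add: below_prob_def)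

lemma below_prob_mono: "t \<le> u \<Longrightarrow> below_prob s t \<le> below_prob s u"
  unfolding below_prob_def by (intro finite_measure_mono) auto

lemma below_prob_antimono: "s \<le> u \<Longrightarrow> below_prob u t \<le> below_prob s t"
proof -
  assume "s \<le> u"
  then have "S (max 0 s) \<omega> \<le> S (max 0 u) \<omega>" if "\<omega> \<in> space M" for \<omega>
    using that by (intro S_mono) auto
  then show ?thesis unfolding below_prob_def by (intro finite_measure_mono) force+
qed

lemma below_prob_left_continuous: "(below_prob s \<longlongrightarrow> below_prob s t) (at_left t)"
proof (rule tendsto_at_left_sequentially[of "t - 1"])
  fix X :: "nat \<Rightarrow> real" assume X: "\<And>n. X n < t" "incseq X" "X \<longlonglongrightarrow> t"
  define A where "A n = {\<omega> \<in> space M. S (max 0 s) \<omega> < X n}" for n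
  have un: "(\<Union>n. A n) = {\<omega> \<in> space M. S (max 0 s) \<omega> < t}"
  proof (intro set_eqI iffI)
    fix \<omega> assume "\<omega> \<in> {\<omega> \<in> space M. S (max 0 s) \<omega> < t}"
    then have \<omega>: "\<omega> \<in> space M" "S (max 0 s) \<omega> < t" by auto
    then have "eventually (\<lambda>n. S (max 0 s) \<omega> < X n) sequentially"
      using X(3) by (intro order_tendstoD)
    then show "\<omega> \<in> (\<Union>n. A n)" using \<omega> by (auto simp: A_def eventually_sequentially)
  qed (use X(1) in \<open>auto simp: A_def intro: less_trans\<close>)
  have "(\<lambda>n. prob (A n)) \<longlonglongrightarrow> prob (\<Union>n. A n)"
    using X(2) by (intro finite_Lim_measure_incseq) (auto simp: A_def incseq_def intro: less_le_trans)
  then show "(\<lambda>n. below_prob s (X n)) \<longlonglongrightarrow> below_prob s t" unfolding un by (simp add: A_def below_prob_def)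
qed simp

lemma below_prob_measurable: "(\<lambda>x. below_prob (fst x) (snd x)) \<in> borel_measurable (borel \<Otimes>\<^sub>M borel)"
proof (rule borel_measurable_mono_left_continuous)
  fix t
  have "mono (\<lambda>s. - below_prob s t)" by (auto simp: mono_def intro: below_prob_antimono)
  then have "(\<lambda>s. - below_prob s t) \<in> borel_measurable borel" by (rule borel_measurable_mono)
  then show "(\<lambda>s. below_prob s t) \<in> borel_measurable borel" by simp
qed (fact below_prob_mono below_prob_left_continuous)+

lemma below_prob_measurable_left [measurable]: "(\<lambda>s. below_prob s t) \<in> borel_measurable borel"
proof -
  have "(\<lambda>s. (s, t)) \<in> borel \<rightarrow>\<^sub>M borel \<Otimes>\<^sub>M borel" by measurable
  from measurable_compose[OF this below_prob_measurable] show ?thesis by simp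
qed

lemma below_prob_measurable_right [measurable]: "below_prob s \<in> borel_measurable borel"
  by (rule borel_measurable_mono) (auto simp: mono_def intro: below_prob_mono)

text \<open>
  The transform of \<open>t \<mapsto> P(S s < t)\<close> is the expectation of the integral of \<open>exp (- \<mu> * t)\<close> over
  \<open>t > S s\<close>, hence \<open>E exp (- \<mu> * S s) / \<mu>\<close>.
\<close>

lemma below_prob_laplace:
  assumes "s \<ge> 0" "\<mu> > 0"
  shows "(\<integral>t. indicator {0<..} t * exp (- \<mu> * t) * below_prob s t \<partial>lborel) = exp (- s * \<phi> \<mu>) / \<mu>"
proof -
  have [measurable]: "random_variable borel (S s)" using assms by (intro S_measurable)
  have outer: "(\<integral>t. indicator {0<..} t * exp (- \<mu> * t) * of_bool (S s \<omega> < t) \<partial>lborel) = exp (- \<mu> * S s \<omega>) / \<mu>"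
    if "\<omega> \<in> space M" for \<omega>
  proof -
    have eq: "indicator {0<..} t * exp (- \<mu> * t) * of_bool (S s \<omega> < t) = indicator {S s \<omega><..} t * exp (- \<mu> * t)" for t
      using S_nonneg[OF that assms(1)] by (auto simp: indicator_def)
    show ?thesis
      unfolding eq using exp_tail_integral[OF assms(2), of "S s \<omega>"] by (simp add: has_bochner_integral_iff)
  qed
  have e: "integrable lborel (\<lambda>t. indicator {0<..} t * exp (- \<mu> * t))"
    using exp_tail_integral[OF assms(2), of 0] by (simp add: has_bochner_integral_iff)
  have "Measurable.pred (lborel \<Otimes>\<^sub>M M) (\<lambda>x. S s (snd x) < fst x)" by measurable
  note swap = integral_times_prob_swap(2)[OF e this]
  have "(\<integral>t. indicator {0<..} t * exp (- \<mu> * t) * below_prob s t \<partial>lborel)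
      = (\<integral>\<omega>. (\<integral>t. indicator {0<..} t * exp (- \<mu> * t) * of_bool (S s \<omega> < t) \<partial>lborel) \<partial>M)"
    unfolding swap using assms(1) by (simp add: below_prob_def max_absorb2)
  also have "\<dots> = (\<integral>\<omega>. exp (- \<mu> * S s \<omega>) / \<mu> \<partial>M)"
    by (rule Bochner_Integration.integral_cong[OF refl outer])
  also have "\<dots> = exp (- s * \<phi> \<mu>) / \<mu>" using S_laplace[OF assms] by simp
  finally show ?thesis .
qed

text \<open>
  Markov's inequality for \<open>exp (- S n)\<close> gives \<open>P(S n < t) \<le> exp t * exp (- n * \<phi> 1)\<close>. So the set in the
  definition of the first passage time is almost surely nonempty.
\<close>

lemma AE_S_unbounded: "AE \<omega> in M. \<exists>n::nat. S (real n) \<omega> \<ge> t"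
proof -
  have [measurable]: "random_variable borel (S (real n))" for n by (rule S_measurable) simp
  define B where "B = {\<omega> \<in> space M. \<forall>n::nat. S (real n) \<omega> < t}"
  have B [measurable]: "B \<in> events" unfolding B_def by measurable
  have le: "prob B \<le> exp t * exp (- real n * \<phi> 1)" for n :: nat
  proof -
    have int: "integrable M (\<lambda>\<omega>. exp (- 1 * S (real n) \<omega>))"
      by (rule integrable_const_bound[where B = 1]) (auto intro!: AE_I2 S_nonneg)
    have "prob B = expectation (indicator B)" by simp
    also have "\<dots> \<le> expectation (\<lambda>\<omega>. exp t * exp (- 1 * S (real n) \<omega>))"
    proof (rule integral_mono)
      show "integrable M (indicator B :: 'a \<Rightarrow> real)"
        by (intro integrable_real_indicator B) (simp add: less_top[symmetric])
      show "integrable M (\<lambda>\<omega>. exp t * exp (- 1 * S (real n) \<omega>))"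
        using int by (rule integrable_mult_right)
      show "indicator B \<omega> \<le> exp t * exp (- 1 * S (real n) \<omega>)" for \<omega>
        by (auto simp: B_def indicator_def mult_exp_exp less_imp_le)
    qed
    also have "\<dots> = exp t * exp (- real n * \<phi> 1)"
      using S_laplace[of "real n" 1] by simp
    finally show ?thesis .
  qed
  have "(\<lambda>n. exp t * exp (- real n * \<phi> 1)) = (\<lambda>n. exp t * exp (- \<phi> 1) ^ n)"
    by (simp add: fun_eq_iff exp_of_nat_mult[symmetric])
  moreover have "(\<lambda>n. exp t * exp (- \<phi> 1) ^ n) \<longlonglongrightarrow> exp t * 0"
    using \<phi>_pos[of 1] by (intro tendsto_mult_left LIMSEQ_realpow_zero) auto
  ultimately have "(\<lambda>n. exp t * exp (- real n * \<phi> 1)) \<longlonglongrightarrow> 0" by simp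
  then have "prob B \<le> 0" using le by (rule_tac LIMSEQ_le_const) blast+
  then have "prob B = 0" by (simp add: measure_le_0_iff)
  then have "AE \<omega> in M. \<omega> \<notin> B" using B prob_eq_0 by blast
  then show ?thesis
    by (rule AE_mp) (auto intro!: AE_I2 simp: B_def not_less)
qed

definition first_passage :: "real \<Rightarrow> 'a \<Rightarrow> real" where
  "first_passage t \<omega> =
     (let A = {s. s > 0 \<and> S s \<omega> \<ge> t} in if t > 0 \<and> A \<noteq> {} then Inf A else 0)"

lemma first_passage_nonneg: "first_passage t \<omega> \<ge> 0"
  unfolding first_passage_def Let_def by (auto intro!: cInf_greatest)

text \<open>
  If \<open>S s < t\<close>, right-continuity keeps the path below \<open>t\<close> up to some time after \<open>s\<close>, and monotonicity
  keeps it there before; hence the inequality between \<open>s\<close> and the first passage time is strict.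
\<close>

lemma first_passage_gt_iff:
  assumes \<omega>: "\<omega> \<in> space M" and n: "S (real n) \<omega> \<ge> t" and t: "t > 0" and s: "s > 0"
  shows "s < first_passage t \<omega> \<longleftrightarrow> S s \<omega> < t"
proof -
  define A where "A = {s. s > 0 \<and> S s \<omega> \<ge> t}"
  have "n \<noteq> 0" using n t S_0[OF \<omega>] by (cases n) auto
  then have "real n \<in> A" using n by (simp add: A_def)
  then have ne: "A \<noteq> {}" by blast
  then have L: "first_passage t \<omega> = Inf A"
    using t unfolding first_passage_def Let_def A_def by simp
  have bdd: "bdd_below A" by (rule bdd_belowI[of _ 0]) (auto simp: A_def)
  show ?thesis
  proof
    assume "s < first_passage t \<omega>"
    then have "s \<notin> A" using cInf_lower[OF _ bdd, of s] L by auto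
    then show "S s \<omega> < t" using s by (simp add: A_def)
  next
    assume less: "S s \<omega> < t"
    have "((\<lambda>u. S u \<omega>) \<longlongrightarrow> S s \<omega>) (at_right s)" using \<omega> s by (intro S_right) auto
    then have "eventually (\<lambda>u. S u \<omega> < t) (at_right s)" using less by (rule order_tendstoD)
    then obtain b where b: "b > s" "\<And>u. s < u \<Longrightarrow> u < b \<Longrightarrow> S u \<omega> < t"
      unfolding eventually_at_right_field by blast
    define c where "c = (s + b) / 2"
    have c: "s < c" "c < b" using b(1) by (auto simp: c_def)
    \<comment> \<open>A positive gap between s and the set A makes the inequality for the infimum strict.\<close>
    have "c \<le> u" if "u \<in> A" for u
    proof (rule ccontr)
      assume "\<not> c \<le> u"
      then have "S u \<omega> \<le> S c \<omega>" using that \<omega> by (intro S_mono) (auto simp: A_def)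
      also have "\<dots> < t" using b(2) c by simp
      finally show False using that by (simp add: A_def)
    qed
    then have "c \<le> Inf A" using ne by (intro cInf_greatest) auto
    then show "s < first_passage t \<omega>" using c L by simp
  qed
qed

lemma prob_first_passage_gt:
  assumes [measurable]: "random_variable borel (first_passage t)" and "t > 0" "s > 0"
  shows "prob {\<omega> \<in> space M. s < first_passage t \<omega>} = below_prob s t"
proof -
  have "AE \<omega> in M. (s < first_passage t \<omega>) = (S (max 0 s) \<omega> < t)"
    using AE_S_unbounded[of t] AE_space
    by eventually_elim (use first_passage_gt_iff assms in \<open>auto simp: max_absorb2\<close>)
  then show ?thesis
    unfolding below_prob_def by (intro finite_measure_eq_AE) auto
qed

lemma expectation_first_passage:
  fixes g g' :: "real \<Rightarrow> real"
  assumes L: "random_variable borel (first_passage t)" and t: "t > 0"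
    and g: "\<And>x. (g has_real_derivative g' x) (at x)" and g': "continuous_on UNIV g'"
    and int: "integrable lborel (\<lambda>s. indicator {0<..} s * g' s)"
  shows "expectation (\<lambda>\<omega>. g (first_passage t \<omega>)) = g 0 + (\<integral>s. indicator {0<..} s * g' s * below_prob s t \<partial>lborel)"
proof -
  have "expectation (\<lambda>\<omega>. g (first_passage t \<omega>)) =
     g 0 + (\<integral>s. indicator {0<..} s * g' s * prob {\<omega> \<in> space M. s < first_passage t \<omega>} \<partial>lborel)"
    using L first_passage_nonneg g g' int by (rule expectation_eq_integral_tail)
  also have "(\<integral>s. indicator {0<..} s * g' s * prob {\<omega> \<in> space M. s < first_passage t \<omega>} \<partial>lborel)
     = (\<integral>s. indicator {0<..} s * g' s * below_prob s t \<partial>lborel)"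
    by (intro Bochner_Integration.integral_cong)
      (auto simp: prob_first_passage_gt[OF L t] split: split_indicator)
  finally show ?thesis .
qed

lemma below_prob_average_left_continuous:
  fixes f :: "real \<Rightarrow> real"
  assumes f: "integrable lborel f"
  shows "((\<lambda>t. \<integral>s. f s * below_prob s t \<partial>lborel) \<longlongrightarrow> (\<integral>s. f s * below_prob s t \<partial>lborel)) (at_left t)"
proof (rule tendsto_at_left_sequentially[of "t - 1"])
  note [measurable] = borel_measurable_integrable[OF f]
  fix X :: "nat \<Rightarrow> real" assume X: "\<And>n. X n < t" "X \<longlonglongrightarrow> t"
  then have "filterlim X (at_left t) sequentially"
    by (intro filterlim_atI tendsto_imp_filterlim_at_left) auto
  then have lim: "(\<lambda>n. below_prob s (X n)) \<longlonglongrightarrow> below_prob s t" for s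
    using filterlim_compose[OF below_prob_left_continuous] by blast
  show "(\<lambda>n. \<integral>s. f s * below_prob s (X n) \<partial>lborel) \<longlonglongrightarrow> (\<integral>s. f s * below_prob s t \<partial>lborel)"
  proof (rule integral_dominated_convergence)
    show "integrable lborel (\<lambda>s. \<bar>f s\<bar>)" using f by simp
    show "AE s in lborel. (\<lambda>n. f s * below_prob s (X n)) \<longlonglongrightarrow> f s * below_prob s t"
      by (intro AE_I2 tendsto_intros lim)
    show "AE s in lborel. norm (f s * below_prob s (X n)) \<le> \<bar>f s\<bar>" for n
      by (intro AE_I2) (auto simp: abs_mult below_prob_bounds intro!: mult_left_le)
  qed measurable
qed simp

text \<open>
  Another use of Fubini, in \<open>s\<close> and \<open>t\<close>, with \<open>below_prob_laplace\<close> for the inner integral.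
\<close>

lemma below_prob_average_laplace:
  fixes f :: "real \<Rightarrow> real"
  assumes f: "integrable lborel f" and f0: "\<And>s. s < 0 \<Longrightarrow> f s = 0" and \<mu>: "\<mu> > 0"
  shows "integrable lborel (\<lambda>t. indicator {0<..} t * exp (- \<mu> * t) * (\<integral>s. f s * below_prob s t \<partial>lborel))"
    and "(\<integral>t. indicator {0<..} t * exp (- \<mu> * t) * (\<integral>s. f s * below_prob s t \<partial>lborel) \<partial>lborel)
      = (\<integral>s. f s * exp (- s * \<phi> \<mu>) \<partial>lborel) / \<mu>"
proof -
  note [measurable] = borel_measurable_integrable[OF f]
  define e where "e t = indicator {0<..} t * exp (- \<mu> * t)" for t :: real
  have [measurable]: "e \<in> borel_measurable borel" unfolding e_def by measurable
  have e: "integrable lborel e"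
    using exp_tail_integral[OF \<mu>, of 0] by (simp add: has_bochner_integral_iff e_def[abs_def])
  have e0: "e t \<ge> 0" for t by (simp add: e_def)
  define h where "h s t = f s * (e t * below_prob s t)" for s t
  have [measurable]: "(\<lambda>x. below_prob (fst x) (snd x)) \<in> borel_measurable (lborel \<Otimes>\<^sub>M lborel)"
    using below_prob_measurable by (simp cong: measurable_cong_sets add: sets_pair_measure_cong[OF sets_lborel sets_lborel])
  have hm [measurable]: "case_prod h \<in> borel_measurable (lborel \<Otimes>\<^sub>M lborel)"
    unfolding h_def case_prod_unfold by measurable
  have eF: "integrable lborel (\<lambda>t. e t * below_prob s t)" for s
    by (rule Bochner_Integration.integrable_bound[OF e]) (auto simp: abs_mult below_prob_bounds intro!: mult_left_le)
  have inth: "integrable (lborel \<Otimes>\<^sub>M lborel) (case_prod h)"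
  proof (rule lborel_pair.Fubini_integrable)
    show "integrable lborel (\<lambda>x. \<integral>y. norm (case (x, y) of (x, xa) \<Rightarrow> h x xa) \<partial>lborel)"
    proof (rule Bochner_Integration.integrable_bound)
      show "integrable lborel (\<lambda>s. \<bar>f s\<bar> * (\<integral>t. e t \<partial>lborel))" using f by simp
      show "AE x in lborel. norm (\<integral>y. norm (case (x, y) of (x, xa) \<Rightarrow> h x xa) \<partial>lborel)
          \<le> norm (\<bar>f x\<bar> * (\<integral>t. e t \<partial>lborel))"
      proof (rule AE_I2)
        fix x
        have "(\<integral>y. \<bar>h x y\<bar> \<partial>lborel) = \<bar>f x\<bar> * (\<integral>y. e y * below_prob x y \<partial>lborel)"
          unfolding h_def abs_mult using e0 below_prob_bounds by (simp add: abs_mult)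
        also have "\<dots> \<le> \<bar>f x\<bar> * (\<integral>y. e y \<partial>lborel)"
          by (intro mult_left_mono integral_mono eF e) (auto intro!: mult_left_le below_prob_bounds e0)
        finally show "norm (\<integral>y. norm (case (x, y) of (x, xa) \<Rightarrow> h x xa) \<partial>lborel)
          \<le> norm (\<bar>f x\<bar> * (\<integral>t. e t \<partial>lborel))"
          using e0 by (simp add: abs_mult)
      qed
    qed measurable
    show "AE x in lborel. integrable lborel (\<lambda>y. case (x, y) of (x, xa) \<Rightarrow> h x xa)"
      unfolding h_def by (simp add: eF)
  qed measurable
  have inner: "(\<integral>s. h s t \<partial>lborel) = indicator {0<..} t * exp (- \<mu> * t) * (\<integral>s. f s * below_prob s t \<partial>lborel)" for t
    by (simp add: h_def e_def mult.left_commute[of "f _"] mult.assoc)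
  show "integrable lborel (\<lambda>t. indicator {0<..} t * exp (- \<mu> * t) * (\<integral>s. f s * below_prob s t \<partial>lborel))"
    using lborel_pair.integrable_snd[OF inth] unfolding inner .
  have "(\<integral>t. (\<integral>s. h s t \<partial>lborel) \<partial>lborel) = (\<integral>s. (\<integral>t. h s t \<partial>lborel) \<partial>lborel)"
    by (rule lborel_pair.Fubini_integral[OF inth])
  also have "\<dots> = (\<integral>s. f s * exp (- s * \<phi> \<mu>) / \<mu> \<partial>lborel)"
  proof (intro Bochner_Integration.integral_cong refl)
    fix s
    show "(\<integral>t. h s t \<partial>lborel) = f s * exp (- s * \<phi> \<mu>) / \<mu>"
      using below_prob_laplace[OF _ \<mu>, of s] f0[of s] by (cases "s \<ge> 0") (auto simp: h_def e_def)
  qed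
  finally show "(\<integral>t. indicator {0<..} t * exp (- \<mu> * t) * (\<integral>s. f s * below_prob s t \<partial>lborel) \<partial>lborel)
      = (\<integral>s. f s * exp (- s * \<phi> \<mu>) \<partial>lborel) / \<mu>"
    unfolding inner by simp
qed

end

section \<open>State probabilities and the series solution\<close>

context laplace_subordinator
begin

text \<open>
  Both sides have the Laplace transform \<open>\<phi> \<mu> / \<mu> * (r ^ k / (r + \<phi> \<mu>) ^ Suc k)\<close> for large \<open>\<mu>\<close>; the
  left side is left-continuous in \<open>t\<close> and the right side is continuous.
\<close>

lemma expectation_poisson_weight_first_passage:
  fixes \<nu> l r t :: real
  assumes L: "\<And>t. t > 0 \<Longrightarrow> random_variable borel (first_passage t)"
    and \<nu>: "\<nu> > 0" and l: "l > 0" and r: "r > 0"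
    and \<phi>: "\<And>\<mu>. \<mu> > 0 \<Longrightarrow> \<phi> \<mu> = \<mu> powr (2 * \<nu>) + 2 * l * \<mu> powr \<nu>"
    and t: "t > 0"
  shows "expectation (\<lambda>\<omega>. poisson_weight r k (first_passage t \<omega>)) = frac_series \<nu> (state_coeff l r k) t"
proof -
  define g where "g = poisson_weight r k"
  define g' where "g' s = r * ((if k = 0 then 0 else poisson_weight r (k - 1) s) - poisson_weight r k s)" for s
  define f where "f s = indicator {0<..} s * g' s" for s
  define g0 where "g0 = g 0"
  have g0: "g0 = (if k = 0 then 1 else 0)" by (simp add: g0_def g_def poisson_weight_def)
  have f_laplace: "has_bochner_integral lborel (\<lambda>s. f s * exp (- s * c))
      (c * (r ^ k / (r + c) ^ Suc k) - g0)" if c: "c \<ge> 0" for c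
  proof -
    define w where "w j s = indicator {0<..} s * (poisson_weight r j s * exp (- s * c))" for j s
    have w: "has_bochner_integral lborel (w j) (r ^ j / (r + c) ^ Suc j)" for j
      unfolding w_def using r c by (rule poisson_weight_laplace)
    have w': "has_bochner_integral lborel (\<lambda>s. if k = 0 then 0 else w (k - 1) s)
        (if k = 0 then 0 else r ^ (k - 1) / (r + c) ^ k)"
      using w[of "k - 1"] by (cases k) auto
    have "has_bochner_integral lborel (\<lambda>s. r * ((if k = 0 then 0 else w (k - 1) s) - w k s))
        (r * ((if k = 0 then 0 else r ^ (k - 1) / (r + c) ^ k) - r ^ k / (r + c) ^ Suc k))"
      by (intro has_bochner_integral_mult_right has_bochner_integral_diff w w')
    also have "(\<lambda>s. r * ((if k = 0 then 0 else w (k - 1) s) - w k s)) = (\<lambda>s. f s * exp (- s * c))"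
      by (auto simp: fun_eq_iff f_def g'_def w_def indicator_def algebra_simps)
    also have "r * ((if k = 0 then 0 else r ^ (k - 1) / (r + c) ^ k) - r ^ k / (r + c) ^ Suc k)
        = c * (r ^ k / (r + c) ^ Suc k) - g0"
    proof -
      define D where "D = r + c"
      have D: "D > 0" "c = D - r" using r c by (auto simp: D_def)
      show ?thesis
        unfolding D_def[symmetric] D(2) using D(1) by (cases k) (simp_all add: g0 field_simps)
    qed
    finally show ?thesis .
  qed
  have f: "integrable lborel f" using f_laplace[of 0] by (simp add: has_bochner_integral_iff)
  define P where "P t = expectation (\<lambda>\<omega>. poisson_weight r k (first_passage t \<omega>))" for t
  have P: "P t = g0 + (\<integral>s. f s * below_prob s t \<partial>lborel)" if "t > 0" for t
    unfolding P_def f_def g0_def g_def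
  proof (rule expectation_first_passage[OF L[OF that] that])
    show "(poisson_weight r k has_real_derivative g' x) (at x)" for x
      unfolding g'_def by (rule poisson_weight_has_derivative)
    show "continuous_on UNIV g'"
      unfolding g'_def using continuous_poisson_weight by (cases k) (auto intro!: continuous_intros)
    show "integrable lborel (\<lambda>s. indicator {0<..} s * g' s)" using f unfolding f_def[abs_def] .
  qed
  define p where "p t = g0 + (\<integral>s. f s * below_prob s t \<partial>lborel)" for t
  have p_laplace: "has_bochner_integral lborel (\<lambda>t. indicator {0<..} t * (exp (- \<mu> * t) * p t))
      (\<phi> \<mu> / \<mu> * (r ^ k / (r + \<phi> \<mu>) ^ Suc k))" if \<mu>: "\<mu> > 0" for \<mu>
  proof -
    have f0: "f s = 0" if "s < 0" for s using that by (simp add: f_def)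
    have I: "(\<integral>s. f s * exp (- s * \<phi> \<mu>) \<partial>lborel) = \<phi> \<mu> * (r ^ k / (r + \<phi> \<mu>) ^ Suc k) - g0"
      using f_laplace[of "\<phi> \<mu>"] \<phi>_pos[OF \<mu>] by (simp add: has_bochner_integral_iff)
    have 1: "has_bochner_integral lborel (\<lambda>t. indicator {0<..} t * exp (- \<mu> * t) * (\<integral>s. f s * below_prob s t \<partial>lborel))
        ((\<phi> \<mu> * (r ^ k / (r + \<phi> \<mu>) ^ Suc k) - g0) / \<mu>)"
      using below_prob_average_laplace[OF f f0 \<mu>] unfolding I by (simp add: has_bochner_integral_iff)
    have 2: "has_bochner_integral lborel (\<lambda>t. g0 * (indicator {0<..} t * exp (- \<mu> * t))) (g0 * (exp (- \<mu> * 0) / \<mu>))"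
      using \<mu> by (intro has_bochner_integral_mult_right exp_tail_integral)
    have "has_bochner_integral lborel
        (\<lambda>t. indicator {0<..} t * exp (- \<mu> * t) * (\<integral>s. f s * below_prob s t \<partial>lborel) + g0 * (indicator {0<..} t * exp (- \<mu> * t)))
        ((\<phi> \<mu> * (r ^ k / (r + \<phi> \<mu>) ^ Suc k) - g0) / \<mu> + g0 * (exp (- \<mu> * 0) / \<mu>))"
      by (rule has_bochner_integral_add[OF 1 2])
    also have "(\<lambda>t. indicator {0<..} t * exp (- \<mu> * t) * (\<integral>s. f s * below_prob s t \<partial>lborel) + g0 * (indicator {0<..} t * exp (- \<mu> * t)))
        = (\<lambda>t. indicator {0<..} t * (exp (- \<mu> * t) * p t))"
      by (simp add: fun_eq_iff p_def algebra_simps)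
    also have "(\<phi> \<mu> * (r ^ k / (r + \<phi> \<mu>) ^ Suc k) - g0) / \<mu> + g0 * (exp (- \<mu> * 0) / \<mu>)
        = \<phi> \<mu> / \<mu> * (r ^ k / (r + \<phi> \<mu>) ^ Suc k)"
      by (simp add: diff_divide_distrib)
    finally show ?thesis .
  qed
  define C where "C = 2 * l + 2 * r + 1"
  have C: "C > 0" using l r by (simp add: C_def add_pos_pos)
  have bd: "\<bar>state_coeff l r k m\<bar> \<le> 1 * C ^ m" for m
    unfolding C_def using l r by (rule state_coeff_bound)
  define q where "q = frac_series \<nu> (state_coeff l r k)"
  \<comment> \<open>Beyond this bound C < \<mu> powr \<nu>, as the transform of the series requires.\<close>
  define \<mu>0 where "\<mu>0 = (C + 1) powr (1 / \<nu>)"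
  have \<mu>: "\<mu> > 0" "C < \<mu> powr \<nu>" if "\<mu> \<ge> \<mu>0" for \<mu>
  proof -
    have "\<mu>0 > 0" using C by (simp add: \<mu>0_def)
    then show "\<mu> > 0" using that by simp
    have "C < \<mu>0 powr \<nu>" using C \<nu> by (simp add: \<mu>0_def powr_powr)
    also have "\<dots> \<le> \<mu> powr \<nu>" using that \<open>\<mu>0 > 0\<close> \<nu> by (intro powr_mono2) auto
    finally show "C < \<mu> powr \<nu>" .
  qed
  have diff: "has_bochner_integral lborel (\<lambda>t. indicator {0<..} t * (exp (- \<mu> * t) * (p t - q t))) 0"
    if "\<mu> \<ge> \<mu>0" for \<mu>
  proof -
    have "has_bochner_integral lborel (\<lambda>t. indicator {0<..} t * (exp (- \<mu> * t) * q t))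
        (\<phi> \<mu> / \<mu> * (r ^ k / (r + \<phi> \<mu>) ^ Suc k))"
      using state_series_laplace[OF \<nu> l r \<mu>(1)[OF that], of k] \<mu>[OF that]
      by (simp add: has_bochner_integral_iff q_def C_def \<phi>)
    from has_bochner_integral_diff[OF p_laplace[OF \<mu>(1)[OF that]] this]
    show ?thesis by (simp add: algebra_simps)
  qed
  have "p t - q t = 0"
  proof (rule laplace_vanishing_left_continuous[of \<mu>0 "\<lambda>t. p t - q t"])
    have "continuous_on {0..} q" unfolding q_def by (rule frac_series_continuous[OF \<nu> C bd])
    then have "continuous_on {0<..} q" by (rule continuous_on_subset) auto
    then have "isCont q t" using t by (simp add: continuous_on_eq_continuous_at)
    then have "(q \<longlongrightarrow> q t) (at_left t)" 
      unfolding isCont_def by (rule tendsto_within_subset) simp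
    then show "((\<lambda>t. p t - q t) \<longlongrightarrow> p t - q t) (at_left t)"
      unfolding p_def by (intro tendsto_intros below_prob_average_left_continuous f)
  qed (use diff t in \<open>auto simp: has_bochner_integral_iff\<close>)
  then show ?thesis using P[OF t] by (simp add: P_def p_def q_def)
qed

end

lemma (in prob_space) indep_processes_at:
  assumes "indep_processes X Y" "s \<ge> 0" "t \<ge> 0"
  shows "indep_var borel (X s) borel (Y t)"
proof -
  have "indep_var borel ((\<lambda>x. x s) \<circ> (\<lambda>\<omega>. \<lambda>t\<in>{0..}. X t \<omega>)) borel ((\<lambda>x. x t) \<circ> (\<lambda>\<omega>. \<lambda>t\<in>{0..}. Y t \<omega>))"
    using assms unfolding indep_processes_def
    by (intro indep_var_compose[where ?M1.0 = "PiM {0..} (\<lambda>_. borel)" and ?M2.0 = "PiM {0..} (\<lambda>_. borel)"])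
      (auto intro!: measurable_component_singleton)
  then show ?thesis using assms by (simp add: comp_def)
qed

text \<open>
  The order \<open>\<beta> = 1\<close> is the deterministic process \<open>t\<close>, which is treated here once and for all so that
  \<open>\<nu> = 1 / 2\<close> needs no separate argument on the probabilistic side.
\<close>

lemma (in prob_space) stable_subordinator_facts:
  assumes H: "stable_subordinator \<beta> H"
  shows "\<And>s. s \<ge> 0 \<Longrightarrow> random_variable borel (H s)"
    and "\<And>\<omega>. \<omega> \<in> space M \<Longrightarrow> H 0 \<omega> = 0"
    and "\<And>\<omega> s t. \<omega> \<in> space M \<Longrightarrow> 0 \<le> s \<Longrightarrow> s \<le> t \<Longrightarrow> H s \<omega> \<le> H t \<omega>"
    and "\<And>\<omega> s. \<omega> \<in> space M \<Longrightarrow> 0 \<le> s \<Longrightarrow> ((\<lambda>u. H u \<omega>) \<longlongrightarrow> H s \<omega>) (at_right s)"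
    and "\<And>s \<mu>. s \<ge> 0 \<Longrightarrow> \<mu> > 0 \<Longrightarrow> expectation (\<lambda>\<omega>. exp (- \<mu> * H s \<omega>)) = exp (- s * \<mu> powr \<beta>)"
proof -
  have "(\<forall>s\<ge>0. random_variable borel (H s)) \<and> (\<forall>\<omega>\<in>space M. H 0 \<omega> = 0) \<and>
    (\<forall>\<omega>\<in>space M. \<forall>s t. 0 \<le> s \<longrightarrow> s \<le> t \<longrightarrow> H s \<omega> \<le> H t \<omega>) \<and>
    (\<forall>\<omega>\<in>space M. \<forall>s\<ge>0. ((\<lambda>u. H u \<omega>) \<longlongrightarrow> H s \<omega>) (at_right s)) \<and>
    (\<forall>s\<ge>0. \<forall>\<mu>>0. expectation (\<lambda>\<omega>. exp (- \<mu> * H s \<omega>)) = exp (- s * \<mu> powr \<beta>))"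
  proof (cases "\<beta> = 1")
    case True
    then have eq: "H t \<omega> = t" if "\<omega> \<in> space M" "t \<ge> 0" for t \<omega>
      using H that by (simp add: stable_subordinator_def)
    have "random_variable borel (H s)" if "s \<ge> 0" for s
      using that eq by (subst measurable_cong[where g = "\<lambda>_. s"]) auto
    moreover have "((\<lambda>u. H u \<omega>) \<longlongrightarrow> H s \<omega>) (at_right s)" if "\<omega> \<in> space M" "s \<ge> 0" for s \<omega>
    proof -
      have "eventually (\<lambda>u. u = H u \<omega>) (at_right s)"
        using that eq by (intro eventually_at_rightI[of s "s + 1"]) auto
      then have "((\<lambda>u. H u \<omega>) \<longlongrightarrow> s) (at_right s)"
        by (rule Lim_transform_eventually[OF tendsto_ident_at])
      then show ?thesis using that eq by simp
    qed
    moreover have "expectation (\<lambda>\<omega>. exp (- \<mu> * H s \<omega>)) = exp (- s * \<mu> powr \<beta>)" if "s \<ge> 0" "\<mu> > 0" for s \<mu>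
    proof -
      have "expectation (\<lambda>\<omega>. exp (- \<mu> * H s \<omega>)) = expectation (\<lambda>\<omega>. exp (- \<mu> * s))"
        using that eq by (intro Bochner_Integration.integral_cong) auto
      then show ?thesis using that True by (simp add: prob_space mult.commute)
    qed
    ultimately show ?thesis using eq by auto
  next
    case False
    then show ?thesis
      using H unfolding stable_subordinator_def levy_process_def mono_on_def by auto
  qed
  then show "\<And>s. s \<ge> 0 \<Longrightarrow> random_variable borel (H s)"
    and "\<And>\<omega>. \<omega> \<in> space M \<Longrightarrow> H 0 \<omega> = 0"
    and "\<And>\<omega> s t. \<omega> \<in> space M \<Longrightarrow> 0 \<le> s \<Longrightarrow> s \<le> t \<Longrightarrow> H s \<omega> \<le> H t \<omega>"
    and "\<And>\<omega> s. \<omega> \<in> space M \<Longrightarrow> 0 \<le> s \<Longrightarrow> ((\<lambda>u. H u \<omega>) \<longlongrightarrow> H s \<omega>) (at_right s)"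
    and "\<And>s \<mu>. s \<ge> 0 \<Longrightarrow> \<mu> > 0 \<Longrightarrow> expectation (\<lambda>\<omega>. exp (- \<mu> * H s \<omega>)) = exp (- s * \<mu> powr \<beta>)"
    by blast+
qed

text \<open>
  The factor \<open>(2 * l) powr (1 / \<nu>)\<close> is chosen so that its power \<open>\<nu>\<close> is \<open>2 * l\<close>.
\<close>

lemma (in prob_space) laplace_subordinator_sum:
  assumes \<nu>: "\<nu> > 0" and l: "l > 0"
    and H1: "stable_subordinator (2 * \<nu>) H1" and H2: "stable_subordinator \<nu> H2"
    and indep: "indep_processes H1 H2"
  shows "laplace_subordinator M (\<lambda>s \<omega>. H1 s \<omega> + (2 * l) powr (1 / \<nu>) * H2 s \<omega>)
           (\<lambda>\<mu>. \<mu> powr (2 * \<nu>) + 2 * l * \<mu> powr \<nu>)"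
proof (intro laplace_subordinator.intro laplace_subordinator_axioms.intro)
  define c where "c = (2 * l) powr (1 / \<nu>)"
  have c: "c > 0" "c powr \<nu> = 2 * l" using l \<nu> by (auto simp: c_def powr_powr)
  note h1 = stable_subordinator_facts[OF H1] and h2 = stable_subordinator_facts[OF H2]
  show "prob_space M" by (rule prob_space_axioms)
  show "random_variable borel (\<lambda>\<omega>. H1 s \<omega> + (2 * l) powr (1 / \<nu>) * H2 s \<omega>)" if "s \<ge> 0" for s
    using h1(1)[OF that] h2(1)[OF that] by measurable
  show "H1 0 \<omega> + (2 * l) powr (1 / \<nu>) * H2 0 \<omega> = 0" if "\<omega> \<in> space M" for \<omega>
    using h1(2)[OF that] h2(2)[OF that] by simp
  show "H1 s \<omega> + (2 * l) powr (1 / \<nu>) * H2 s \<omega> \<le> H1 t \<omega> + (2 * l) powr (1 / \<nu>) * H2 t \<omega>"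
    if "\<omega> \<in> space M" "0 \<le> s" "s \<le> t" for \<omega> s t
    using h1(3)[OF that] h2(3)[OF that] by (intro add_mono mult_left_mono) auto
  show "((\<lambda>u. H1 u \<omega> + (2 * l) powr (1 / \<nu>) * H2 u \<omega>) \<longlongrightarrow> H1 s \<omega> + (2 * l) powr (1 / \<nu>) * H2 s \<omega>) (at_right s)"
    if "\<omega> \<in> space M" "0 \<le> s" for \<omega> s
    using h1(4)[OF that] h2(4)[OF that] by (intro tendsto_intros)
  show "\<mu> powr (2 * \<nu>) + 2 * l * \<mu> powr \<nu> > 0" if "\<mu> > 0" for \<mu>
    using that l by (intro add_pos_pos mult_pos_pos) auto
  fix s \<mu> :: real assume s: "s \<ge> 0" and \<mu>: "\<mu> > 0"
  have iv: "indep_var borel (\<lambda>\<omega>. exp (- \<mu> * H1 s \<omega>)) borel (\<lambda>\<omega>. exp (- (\<mu> * c) * H2 s \<omega>))"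
    using indep_var_compose[OF indep_processes_at[OF indep s s], of "\<lambda>x. exp (- \<mu> * x)" borel "\<lambda>x. exp (- (\<mu> * c) * x)" borel]
    by (simp add: comp_def)
  have int: "integrable M (\<lambda>\<omega>. exp (- a * H s \<omega>))" if H: "stable_subordinator \<beta> H" and a: "a > 0" for a \<beta> H
  proof (rule integrable_const_bound[where B = 1])
    note h = stable_subordinator_facts[OF H]
    have "0 \<le> H s \<omega>" if "\<omega> \<in> space M" for \<omega> using h(3)[OF that order_refl s] h(2)[OF that] by simp
    then show "AE \<omega> in M. norm (exp (- a * H s \<omega>)) \<le> 1" using a by (intro AE_I2) auto
    show "(\<lambda>\<omega>. exp (- a * H s \<omega>)) \<in> borel_measurable M" using h(1)[OF s] by measurable
  qed
  have "expectation (\<lambda>\<omega>. exp (- \<mu> * (H1 s \<omega> + c * H2 s \<omega>)))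
      = expectation (\<lambda>\<omega>. exp (- \<mu> * H1 s \<omega>) * exp (- (\<mu> * c) * H2 s \<omega>))"
    by (simp add: mult_exp_exp algebra_simps)
  also have "\<dots> = expectation (\<lambda>\<omega>. exp (- \<mu> * H1 s \<omega>)) * expectation (\<lambda>\<omega>. exp (- (\<mu> * c) * H2 s \<omega>))"
    using \<mu> c by (intro indep_var_lebesgue_integral int[OF H1] int[OF H2] iv) auto
  also have "\<dots> = exp (- s * \<mu> powr (2 * \<nu>)) * exp (- s * (\<mu> * c) powr \<nu>)"
    by (simp only: h1(5)[OF s \<mu>] h2(5)[OF s mult_pos_pos[OF \<mu> c(1)]])
  also have "\<dots> = exp (- s * (\<mu> powr (2 * \<nu>) + 2 * l * \<mu> powr \<nu>))"
    using \<mu> c by (simp add: mult_exp_exp powr_mult algebra_simps)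
  finally show "expectation (\<lambda>\<omega>. exp (- \<mu> * (H1 s \<omega> + (2 * l) powr (1 / \<nu>) * H2 s \<omega>)))
      = exp (- s * (\<mu> powr (2 * \<nu>) + 2 * l * \<mu> powr \<nu>))" unfolding c_def .
qed

theorem theorem5:
  fixes M :: "'a measure" and N :: "real \<Rightarrow> 'a \<Rightarrow> nat" and H1 H2 L :: "real \<Rightarrow> 'a \<Rightarrow> real"
    and \<nu> l \<Lambda> :: real and p :: "nat \<Rightarrow> real \<Rightarrow> real"
  assumes "prob_space M"
    and "0 < \<nu>" and "\<nu> \<le> 1 / 2" and "l > 0" and "\<Lambda> > 0"
    and "prob_space.poisson_process M \<Lambda> N"
    and "prob_space.stable_subordinator M (2 * \<nu>) H1"
    and "prob_space.stable_subordinator M \<nu> H2"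
    and "prob_space.indep_processes M H1 H2"
    and "L = inverse_process \<nu> l H1 H2"
    and "prob_space.indep_processes M (\<lambda>t \<omega>. real (N t \<omega>)) L"
    and "p = prob_space.time_changed_prob M N L"
  shows "(\<forall>k. \<forall>t>0.
            caputo_differentiable (2 * \<nu>) (p k) t \<and> caputo_differentiable \<nu> (p k) t \<and>
            caputo_deriv (2 * \<nu>) (p k) t + 2 * l * caputo_deriv \<nu> (p k) t
              = - \<Lambda> * (p k t - (if k = 0 then 0 else p (k - 1) t))) \<and>
         (\<forall>k. p k 0 = (if k = 0 then 1 else 0))"
proof -
  interpret prob_space M by fact
  interpret S: laplace_subordinator M "\<lambda>s \<omega>. H1 s \<omega> + (2 * l) powr (1 / \<nu>) * H2 s \<omega>"
      "\<lambda>\<mu>. \<mu> powr (2 * \<nu>) + 2 * l * \<mu> powr \<nu>"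
    using assms by (intro laplace_subordinator_sum)
  have L: "L = S.first_passage"
    unfolding assms(10) by (intro ext) (simp add: inverse_process_def S.first_passage_def)
  have ind: "indep_var borel (\<lambda>\<omega>. real (N s \<omega>)) borel (L t)" if "s \<ge> 0" "t \<ge> 0" for s t
    using indep_processes_at[OF assms(11) that] .
  have Lm: "random_variable borel (L t)" if "t \<ge> 0" for t
    using indep_var_rv2[OF ind[OF order_refl that]] .
  have p0: "p k 0 = (if k = 0 then 1 else 0)" for k
  proof -
    have "N (L 0 \<omega>) \<omega> = 0" if "\<omega> \<in> space M" for \<omega>
      using assms(6) that by (simp add: L S.first_passage_def poisson_process_def levy_process_def)
    then have "{\<omega> \<in> space M. N (L 0 \<omega>) \<omega> = k} = (if k = 0 then space M else {})" by auto
    then show ?thesis by (simp add: assms(12) time_changed_prob_def prob_space)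
  qed
  define q where "q k = frac_series \<nu> (state_coeff l \<Lambda> k)" for k
  have pq: "p k t = q k t" if "t \<ge> 0" for k t
  proof (cases "t = 0")
    case True
    then show ?thesis by (simp add: p0 q_def frac_series_0)
  next
    case False
    then have t: "t > 0" using that by simp
    have "p k t = expectation (\<lambda>\<omega>. poisson_weight \<Lambda> k (L t \<omega>))"
      unfolding assms(12) time_changed_prob_def
      using assms(5) ind[OF _ that] by (intro poisson_at_independent_time assms(6))
        (auto simp: L S.first_passage_nonneg)
    also have "\<dots> = q k t"
      unfolding q_def L
      using Lm assms(2,4,5) t by (intro S.expectation_poisson_weight_first_passage) (auto simp: L)
    finally show ?thesis .
  qed
  have "caputo_differentiable (2 * \<nu>) (p k) t \<and> caputo_differentiable \<nu> (p k) t \<and>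
            caputo_deriv (2 * \<nu>) (p k) t + 2 * l * caputo_deriv \<nu> (p k) t
              = - \<Lambda> * (p k t - (if k = 0 then 0 else p (k - 1) t))" if t: "t > 0" for k t
    using state_series_equation[OF assms(2-5) t, of k] t
    by (simp add: caputo_cong[OF t pq] pq q_def)
  then show ?thesis using p0 by blast
qed

end
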